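(* The functions $I^4(\tau)+J^{-4}(\tau)$ and $J^4(\tau)+I^{-4}(\tau)$ are modular functions on $\Gamma_0(10)$ and satisfy, with $U(\tau)=I(\tau)/J(\tau)$, \[ I^4(\tau)+\frac{1}{J^4(\tau)}=\frac{1}{U^2(\tau)}-2+3U^2(\tau),\qquad J^4(\tau)+\frac{1}{I^4(\tau)}=\frac{1}{U^6(\tau)}-\frac{2}{U^4(\tau)}+\frac{3}{U^2(\tau)}. \]
   Context: Throughout, $\tau\in\mathbb{H}$, $q=e^{2\pi i\tau}$, $q^r=e^{2\pi i r\tau}$ for rational $r$, $(a;q)_\infty=\prod_{n\ge0}(1-aq^n)$. Define $I(\tau)=q^{3/4}\dfrac{(q;q^{10})_\infty(q^9;q^{10})_\infty}{(q^4;q^{10})_\infty(q^6;q^{10})_\infty}$ and $J(\tau)=q^{1/4}\dfrac{(q^2;q^{10})_\infty(q^8;q^{10})_\infty}{(q^3;q^{10})_\infty(q^7;q^{10})_\infty}$. A modular function on a congruence subgroup $\Gamma$ is a function meromorphic on $\mathbb{H}$, invariant under $\Gamma$, and meromorphic at all cusps. $\Gamma_0(10)$ is the group of matrices in $\mathrm{SL}_2(\mathbb{Z})$ with lower-left entry divisible by $10$. *)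

theory Defs
  imports "HOL-Complex_Analysis.Complex_Analysis"
begin

definition upper_half_plane :: "complex set" where
  "upper_half_plane = {z. Im z > 0}"

definition qq :: "complex \<Rightarrow> complex" where
  "qq \<tau> = exp (2 * of_real pi * \<i> * \<tau>)"

definition qpow :: "rat \<Rightarrow> complex \<Rightarrow> complex" where
  "qpow r \<tau> = exp (2 * of_real pi * \<i> * of_real (of_rat r) * \<tau>)"

definition qpochinf :: "complex \<Rightarrow> complex \<Rightarrow> complex" where
  "qpochinf a q = (\<Prod>n. 1 - a * q ^ n)"

definition I_fun :: "complex \<Rightarrow> complex" where
  "I_fun \<tau> = qpow (3/4) \<tau> *
     (qpochinf (qq \<tau>) (qq \<tau> ^ 10) * qpochinf (qq \<tau> ^ 9) (qq \<tau> ^ 10)) /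
     (qpochinf (qq \<tau> ^ 4) (qq \<tau> ^ 10) * qpochinf (qq \<tau> ^ 6) (qq \<tau> ^ 10))"

definition J_fun :: "complex \<Rightarrow> complex" where
  "J_fun \<tau> = qpow (1/4) \<tau> *
     (qpochinf (qq \<tau> ^ 2) (qq \<tau> ^ 10) * qpochinf (qq \<tau> ^ 8) (qq \<tau> ^ 10)) /
     (qpochinf (qq \<tau> ^ 3) (qq \<tau> ^ 10) * qpochinf (qq \<tau> ^ 7) (qq \<tau> ^ 10))"

definition moebius_int :: "int \<Rightarrow> int \<Rightarrow> int \<Rightarrow> int \<Rightarrow> complex \<Rightarrow> complex" where
  "moebius_int a b c d \<tau> = (of_int a * \<tau> + of_int b) / (of_int c * \<tau> + of_int d)"

definition Gamma0 :: "int \<Rightarrow> (int \<times> int \<times> int \<times> int) set" where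
  "Gamma0 N = {(a, b, c, d). a * d - b * c = 1 \<and> N dvd c}"

text \<open>Meromorphic at the cusp i*infinity: g(tau) = F(exp(2 pi i tau / h)) on the upper
  half plane for some width h > 0, with F having an isolated, non-essential
  singularity at 0 (i.e. a Laurent expansion in q_h with finitely many negative terms).\<close>
definition meromorphic_at_i_infinity :: "(complex \<Rightarrow> complex) \<Rightarrow> bool" where
  "meromorphic_at_i_infinity g \<longleftrightarrow>
     (\<exists>h::nat. h > 0 \<and> (\<exists>F. (\<forall>\<tau>\<in>upper_half_plane.
         g \<tau> = F (exp (2 * of_real pi * \<i> * \<tau> / of_nat h))) \<and>
       isolated_singularity_at F 0 \<and> not_essential F 0))"

definition modular_function_on ::
    "(complex \<Rightarrow> complex) \<Rightarrow> (int \<times> int \<times> int \<times> int) set \<Rightarrow> bool" where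
  "modular_function_on f G \<longleftrightarrow>
     f meromorphic_on upper_half_plane \<and>
     (\<forall>(a, b, c, d)\<in>G. \<forall>\<tau>\<in>upper_half_plane. f (moebius_int a b c d \<tau>) = f \<tau>) \<and>
     (\<forall>a b c d. a * d - b * c = 1 \<longrightarrow>
        meromorphic_at_i_infinity (\<lambda>\<tau>. f (moebius_int a b c d \<tau>)))"

end

theory Submission
  imports Defs
begin

text \<open>
  Write \<open>a\<^sub>k = (q\<^sup>k; q\<^bsup>10\<^esup>)\<^sub>\<infinity> (q\<^bsup>10-k\<^esup>; q\<^bsup>10\<^esup>)\<^sub>\<infinity>\<close> and \<open>\<kappa> = I J\<close>. Since \<open>I\<^sup>4 = \<kappa>\<^sup>2 U\<^sup>2\<close>
  and \<open>J\<^sup>4 = \<kappa>\<^sup>2 / U\<^sup>2\<close>, both identities follow from \<open>1/\<kappa> - \<kappa> = 1/U\<^sup>2 - 1\<close>.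

  Let \<open>\<wp>\<close> belong to the lattice \<open>\<int> 10\<tau> + \<int>\<close> and put \<open>P\<^sub>i = \<wp>(i\<tau>)\<close>. By Liouville's theorem
  \<open>P\<^sub>i - P\<^sub>j = C q\<^sup>j a\<^bsub>i+j\<^esub> a\<^bsub>i-j\<^esub> / (a\<^sub>i\<^sup>2 a\<^sub>j\<^sup>2)\<close> with \<open>C\<close> independent of \<open>i\<close> and \<open>j\<close>. Inserting this into
  \<open>(P\<^sub>5 - P\<^sub>4) + (P\<^sub>4 - P\<^sub>2) = P\<^sub>5 - P\<^sub>2\<close> and
  \<open>(P\<^sub>3 - P\<^sub>1)(P\<^sub>4 - P\<^sub>2) - (P\<^sub>3 - P\<^sub>2)(P\<^sub>4 - P\<^sub>1) = (P\<^sub>4 - P\<^sub>3)(P\<^sub>2 - P\<^sub>1)\<close>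
  gives two theta relations whose combination is the required identity.

  Moreover \<open>U\<^sup>2 = (P\<^sub>4 - P\<^sub>2) / (P\<^sub>3 - P\<^sub>1)\<close>. A matrix of \<open>\<Gamma>\<^sub>0(10)\<close> with upper left entry \<open>a\<close> permutes the
  \<open>P\<^sub>i\<close> by \<open>i \<mapsto> a i\<close> modulo \<open>10\<close>, up to a common factor; as \<open>P\<^sub>-\<^sub>i = P\<^sub>i\<close>, it either fixes all four of
  them or swaps \<open>1\<close> with \<open>3\<close> and \<open>2\<close> with \<open>4\<close>, so that \<open>U\<^sup>2\<close> is invariant. At the cusps numerator and
  denominator are lattice sums of polynomial growth, hence have no essential singularity in \<open>q\<^bsup>1/10\<^esup>\<close>.
\<close>

section \<open>Lattice sums\<close>

definition lat :: "complex \<Rightarrow> complex \<Rightarrow> int \<times> int \<Rightarrow> complex" where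
  "lat \<omega>\<^sub>1 \<omega>\<^sub>2 = (\<lambda>(m, n). of_int m * \<omega>\<^sub>1 + of_int n * \<omega>\<^sub>2)"

text \<open>The summand 1 keeps the weight at least 1 at the origin too, so that it can be divided
  by and can absorb bounded shifts of a point.\<close>

definition weight :: "int \<times> int \<Rightarrow> real" where
  "weight = (\<lambda>(m, n). 1 + \<bar>real_of_int m\<bar> + \<bar>real_of_int n\<bar>)"

lemma weight_ge_1: "weight p \<ge> 1"
  by (cases p) (simp add: weight_def)

lemma weight_pos [simp]: "weight p > 0"
  using weight_ge_1[of p] by linarith

text \<open>The exponent -3/2 is half of -3, the decay rate of the double series, and still lies
  below -1.\<close>

lemma summable_on_int_powr: "(\<lambda>n::int. (1 + \<bar>real_of_int n\<bar>) powr (-3/2)) summable_on UNIV"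
proof -
  let ?f = "\<lambda>n::int. (1 + \<bar>real_of_int n\<bar>) powr (-3/2)"
  have "summable (\<lambda>n. real n powr (-3/2))"
    by (subst summable_real_powr_iff) auto
  hence "summable (\<lambda>n. real (Suc n) powr (-3/2))"
    by (subst summable_Suc_iff)
  hence "(\<lambda>n. real (Suc n) powr (-3/2)) summable_on (UNIV :: nat set)"
    by (intro norm_summable_imp_summable_on) auto
  hence nat: "(?f \<circ> int) summable_on UNIV" "(?f \<circ> (\<lambda>n. - int n)) summable_on UNIV"
    by (simp_all add: o_def add_ac)
  have "?f summable_on (range int)" "?f summable_on (range (\<lambda>n. - int n))"
    using nat by (subst summable_on_reindex; simp add: inj_def)+
  hence "?f summable_on (range int \<union> range (\<lambda>n. - int n))"
    by (rule summable_on_union)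
  also have "range int \<union> range (\<lambda>n. - int n) = UNIV"
    by (auto simp: image_iff) (metis int_cases)
  finally show ?thesis .
qed

text \<open>The weight dominates both 1 + |m| and 1 + |n|, so its cube dominates the product of
  their powers with exponent 3/2. The double sum is thus bounded by a product of two convergent
  single sums.\<close>

lemma summable_on_weight: "(\<lambda>p. 1 / weight p ^ 3) summable_on UNIV"
proof -
  let ?f = "\<lambda>n::int. (1 + \<bar>real_of_int n\<bar>) powr (-3/2)"
  have "(\<lambda>p. ?f (fst p) * ?f (snd p)) summable_on (UNIV \<times> UNIV)"
    by (rule summable_on_SigmaI[where g = "\<lambda>m. ?f m * infsum ?f UNIV"])
       (use summable_on_int_powr in
         \<open>auto intro!: has_sum_cmult_right has_sum_infsum summable_on_cmult_left\<close>)
  hence "(\<lambda>p. ?f (fst p) * ?f (snd p)) summable_on UNIV"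
    by simp
  thus ?thesis
  proof (rule summable_on_comparison_test)
    fix p :: "int \<times> int"
    obtain m n where p: "p = (m, n)" by (cases p)
    define x y where "x = 1 + \<bar>real_of_int m\<bar>" and "y = 1 + \<bar>real_of_int n\<bar>"
    have xy: "x > 0" "y > 0" "x \<le> weight p" "y \<le> weight p"
      by (auto simp: x_def y_def p weight_def)
    have "x powr (3/2) * y powr (3/2) \<le> weight p powr (3/2) * weight p powr (3/2)"
      using xy by (intro mult_mono powr_mono2) auto
    also have "\<dots> = weight p powr 3"
      by (simp flip: powr_add)
    also have "\<dots> = weight p ^ 3"
      using powr_realpow[of "weight p" 3] by simp
    finally have "1 / weight p ^ 3 \<le> 1 / (x powr (3/2) * y powr (3/2))"
      using xy by (intro divide_left_mono mult_pos_pos) auto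
    also have "\<dots> = x powr (-3/2) * y powr (-3/2)"
      by (simp add: powr_minus field_simps)
    finally show "1 / weight p ^ 3 \<le> ?f (fst p) * ?f (snd p)"
      by (simp add: p x_def y_def)
  qed (auto simp: less_imp_le)
qed

text \<open>The difference factors as (v - u)(1/(u v^2) + 1/(u^2 v)). This gains one order of decay
  over the single terms, from quadratic to cubic, which is what makes the double series converge
  absolutely.\<close>

lemma inverse_square_diff_bound:
  fixes u v :: complex
  assumes "c > 0" "s > 0" "c * s \<le> norm u" "c * s \<le> norm v"
  shows "norm (1 / u ^ 2 - 1 / v ^ 2) \<le> norm (u - v) * (2 / c ^ 3) * (1 / s ^ 3)"
proof -
  have cs: "c * s > 0" using assms by simp
  hence nz: "norm u > 0" "norm v > 0" using assms by linarith+
  hence "u \<noteq> 0" "v \<noteq> 0" by auto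
  have "1 / u ^ 2 - 1 / v ^ 2 = (v - u) * (1 / (u * v ^ 2) + 1 / (u ^ 2 * v))"
    using \<open>u \<noteq> 0\<close> \<open>v \<noteq> 0\<close> by (simp add: field_simps power2_eq_square)
  hence "norm (1 / u ^ 2 - 1 / v ^ 2) = norm (u - v) * norm (1 / (u * v ^ 2) + 1 / (u ^ 2 * v))"
    by (simp add: norm_mult norm_minus_commute)
  also have "\<dots> \<le> norm (u - v) * (1 / (c * s) ^ 3 + 1 / (c * s) ^ 3)"
  proof (intro mult_left_mono order_trans[OF norm_triangle_ineq] add_mono)
    have "(c * s) * (c * s) ^ 2 \<le> norm u * norm v ^ 2"
      using cs assms by (intro mult_mono power_mono) auto
    hence "1 / (norm u * norm v ^ 2) \<le> 1 / ((c * s) * (c * s) ^ 2)"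
      using assms nz by (intro divide_left_mono mult_pos_pos zero_less_power) auto
    thus "norm (1 / (u * v ^ 2)) \<le> 1 / (c * s) ^ 3"
      by (simp add: norm_divide norm_mult norm_power power3_eq_cube power2_eq_square mult_ac)
    have "(c * s) ^ 2 * (c * s) \<le> norm u ^ 2 * norm v"
      using cs assms by (intro mult_mono power_mono) auto
    hence "1 / (norm u ^ 2 * norm v) \<le> 1 / ((c * s) ^ 2 * (c * s))"
      using assms nz by (intro divide_left_mono mult_pos_pos zero_less_power) auto
    thus "norm (1 / (u ^ 2 * v)) \<le> 1 / (c * s) ^ 3"
      by (simp add: norm_divide norm_mult norm_power power3_eq_cube power2_eq_square mult_ac)
  qed auto
  also have "\<dots> = norm (u - v) * (2 / c ^ 3) * (1 / s ^ 3)"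
    by (simp add: power_mult_distrib)
  finally show ?thesis .
qed

text \<open>A quantitative form of avoiding the lattice. The constant \<open>c\<close> is explicit
  so that estimates can be uniform in a parameter; the index set \<open>A\<close> allows the terms
  with a pole to be left out.\<close>

definition separated :: "(int \<times> int) set \<Rightarrow> real \<Rightarrow> complex \<Rightarrow> complex \<Rightarrow> complex \<Rightarrow> bool" where
  "separated A c \<omega>\<^sub>1 \<omega>\<^sub>2 z \<longleftrightarrow> c > 0 \<and> (\<forall>p\<in>A. c * weight p \<le> norm (z + lat \<omega>\<^sub>1 \<omega>\<^sub>2 p))"

lemma separated_mono:
  assumes "separated A c \<omega>\<^sub>1 \<omega>\<^sub>2 z" "0 < c'" "c' \<le> c"
  shows "separated A c' \<omega>\<^sub>1 \<omega>\<^sub>2 z"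
  unfolding separated_def
proof (intro conjI ballI)
  fix p assume "p \<in> A"
  have "c' * weight p \<le> c * weight p"
    using assms by (intro mult_right_mono) (auto simp: less_imp_le)
  thus "c' * weight p \<le> norm (z + lat \<omega>\<^sub>1 \<omega>\<^sub>2 p)"
    using assms(1) \<open>p \<in> A\<close> order_trans unfolding separated_def by blast
qed (use assms in auto)

text \<open>Weights are at least 1, so a shift by at most \<open>c / 2\<close> costs at most half of
  the lower bound \<open>c * weight p\<close>.\<close>

lemma separated_near:
  assumes "separated A c \<omega>\<^sub>1 \<omega>\<^sub>2 z" "norm (z' - z) \<le> c / 2"
  shows "separated A (c / 2) \<omega>\<^sub>1 \<omega>\<^sub>2 z'"
  unfolding separated_def
proof (intro conjI ballI)
  fix p assume p: "p \<in> A"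
  have "norm (z + lat \<omega>\<^sub>1 \<omega>\<^sub>2 p) \<le> norm (z' + lat \<omega>\<^sub>1 \<omega>\<^sub>2 p) + norm (z' - z)"
    using norm_triangle_ineq4[of "z' + lat \<omega>\<^sub>1 \<omega>\<^sub>2 p" "z' - z"] by (simp add: add.commute)
  moreover have "c * weight p \<le> norm (z + lat \<omega>\<^sub>1 \<omega>\<^sub>2 p)"
    using assms p by (auto simp: separated_def)
  moreover have "c / 2 * 1 \<le> c / 2 * weight p"
    using assms weight_ge_1 by (intro mult_left_mono) (auto simp: separated_def)
  ultimately show "c / 2 * weight p \<le> norm (z' + lat \<omega>\<^sub>1 \<omega>\<^sub>2 p)"
    using assms(2) by (simp add: field_simps)
qed (use assms in \<open>auto simp: separated_def\<close>)

lemma separatedD: "separated A c \<omega>\<^sub>1 \<omega>\<^sub>2 z \<Longrightarrow> p \<in> A \<Longrightarrow> z + lat \<omega>\<^sub>1 \<omega>\<^sub>2 p \<noteq> 0"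
  unfolding separated_def using weight_pos[of p]
  by (metis mult_pos_pos norm_zero not_less)

text \<open>Multiplying the vector by the conjugate of one period and taking imaginary parts
  isolates the coefficient of the other period, times the determinant of the lattice.\<close>

lemma lattice_lower_bound:
  fixes x y :: real
  shows "\<bar>Im (\<omega>\<^sub>1 * cnj \<omega>\<^sub>2)\<bar> * (\<bar>x\<bar> + \<bar>y\<bar>) \<le> norm (of_real x * \<omega>\<^sub>1 + of_real y * \<omega>\<^sub>2) * (norm \<omega>\<^sub>1 + norm \<omega>\<^sub>2)"
proof -
  let ?l = "of_real x * \<omega>\<^sub>1 + of_real y * \<omega>\<^sub>2"
  have "\<bar>Im (\<omega>\<^sub>1 * cnj \<omega>\<^sub>2)\<bar> * \<bar>x\<bar> = \<bar>Im (?l * cnj \<omega>\<^sub>2)\<bar>"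
    by (simp add: algebra_simps flip: abs_mult)
  also have "\<dots> \<le> norm ?l * norm \<omega>\<^sub>2"
    by (metis abs_Im_le_cmod complex_mod_cnj norm_mult)
  finally have 1: "\<bar>Im (\<omega>\<^sub>1 * cnj \<omega>\<^sub>2)\<bar> * \<bar>x\<bar> \<le> norm ?l * norm \<omega>\<^sub>2" .
  have "\<bar>Im (\<omega>\<^sub>1 * cnj \<omega>\<^sub>2)\<bar> * \<bar>y\<bar> = \<bar>- Im (?l * cnj \<omega>\<^sub>1)\<bar>"
    by (simp only: flip: abs_mult) (simp add: algebra_simps)
  also have "\<dots> \<le> norm ?l * norm \<omega>\<^sub>1"
    by (metis abs_Im_le_cmod abs_minus_cancel complex_mod_cnj norm_mult)
  finally show ?thesis using 1 by (simp add: algebra_simps)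
qed

lemma finite_positive_lower_bound:
  fixes f :: "'a \<Rightarrow> real"
  assumes "finite B" "\<And>p. p \<in> B \<Longrightarrow> f p > 0"
  shows "\<exists>c>0. \<forall>p\<in>B. c \<le> f p"
  using assms
proof (induction B)
  case (insert x B)
  then obtain c where "c > 0" "\<forall>p\<in>B. c \<le> f p" by auto
  with insert.prems[of x] show ?case
    by (intro exI[of _ "min c (f x)"]) auto
qed (auto intro: exI[of _ 1])

text \<open>Far out, lattice vectors grow linearly in the weight and dominate \<open>z\<close>; the
  finitely many remaining indices contribute a positive minimum.\<close>

lemma ex_separated:
  assumes D: "Im (\<omega>\<^sub>1 * cnj \<omega>\<^sub>2) \<noteq> 0" and z: "\<And>p. p \<in> A \<Longrightarrow> z + lat \<omega>\<^sub>1 \<omega>\<^sub>2 p \<noteq> 0"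
  shows "\<exists>c. separated A c \<omega>\<^sub>1 \<omega>\<^sub>2 z"
proof -
  define c0 where "c0 = \<bar>Im (\<omega>\<^sub>1 * cnj \<omega>\<^sub>2)\<bar> / (norm \<omega>\<^sub>1 + norm \<omega>\<^sub>2)"
  have "norm \<omega>\<^sub>1 + norm \<omega>\<^sub>2 > 0"
    using D by (metis add_nonneg_eq_0_iff complex_cnj_zero mult_zero_left norm_ge_zero norm_eq_zero
                zero_complex.sel(2) add_nonneg_nonneg less_eq_real_def)
  hence c0: "c0 > 0" and lb: "c0 * (weight p - 1) \<le> norm (lat \<omega>\<^sub>1 \<omega>\<^sub>2 p)" for p
    using D lattice_lower_bound[of \<omega>\<^sub>1 \<omega>\<^sub>2 "of_int (fst p)" "of_int (snd p)"]
    by (auto simp: c0_def weight_def lat_def pos_divide_le_eq pos_le_divide_eq split: prod.splits)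
  \<comment> \<open>Beyond this weight, \<open>c0 * (weight p - 1)\<close> is at least 2|z| + 1, so
    subtracting |z| from the lattice vector still leaves half of that lower bound plus 1/2.\<close>
  define K where "K = (2 * norm z + 1) / c0 + 1"
  define B where "B = {p\<in>A. weight p \<le> K}"
  have "finite B"
  proof (rule finite_subset)
    show "B \<subseteq> {-\<lceil>K\<rceil>..\<lceil>K\<rceil>} \<times> {-\<lceil>K\<rceil>..\<lceil>K\<rceil>}"
      unfolding B_def weight_def by (auto; linarith)
  qed auto
  then obtain c1 where c1: "c1 > 0" "\<And>p. p \<in> B \<Longrightarrow> c1 \<le> norm (z + lat \<omega>\<^sub>1 \<omega>\<^sub>2 p) / weight p"
    using finite_positive_lower_bound[of B "\<lambda>p. norm (z + lat \<omega>\<^sub>1 \<omega>\<^sub>2 p) / weight p"] z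
    by (auto simp: B_def)
  \<comment> \<open>The entry 1/2 pays for the constant summand 1 of the weight, \<open>c0/2\<close>
    for its growing part, and \<open>c1\<close> for the finite set \<open>B\<close>.\<close>
  define c where "c = min c1 (min (c0/2) (1/2))"
  have c: "c > 0" "c \<le> c1" "c \<le> c0 / 2" "c \<le> 1/2"
    using c0 c1 by (auto simp: c_def)
  have "separated A c \<omega>\<^sub>1 \<omega>\<^sub>2 z"
    unfolding separated_def
  proof (intro conjI ballI)
    fix p assume p: "p \<in> A"
    show "c * weight p \<le> norm (z + lat \<omega>\<^sub>1 \<omega>\<^sub>2 p)"
    proof (cases "p \<in> B")
      case True
      have "c * weight p \<le> c1 * weight p"
        using c by (intro mult_right_mono) (auto simp: less_imp_le)
      also have "\<dots> \<le> norm (z + lat \<omega>\<^sub>1 \<omega>\<^sub>2 p)"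
        using c1(2)[OF True] by (simp add: field_simps)
      finally show ?thesis .
    next
      case False
      hence "(2 * norm z + 1) / c0 \<le> weight p - 1"
        using p by (auto simp: B_def K_def)
      hence *: "2 * norm z + 1 \<le> c0 * (weight p - 1)"
        using c0 by (simp add: field_simps)
      have "norm (lat \<omega>\<^sub>1 \<omega>\<^sub>2 p) \<le> norm (z + lat \<omega>\<^sub>1 \<omega>\<^sub>2 p) + norm z"
        using norm_triangle_ineq4[of "z + lat \<omega>\<^sub>1 \<omega>\<^sub>2 p" z] by simp
      with lb[of p] * have **: "c0 / 2 * (weight p - 1) + 1 / 2 \<le> norm (z + lat \<omega>\<^sub>1 \<omega>\<^sub>2 p)"
        by (simp add: field_simps)
      have "c * (weight p - 1) \<le> c0 / 2 * (weight p - 1)"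
        using c weight_ge_1 by (intro mult_right_mono) auto
      moreover have "c * weight p = c * (weight p - 1) + c"
        by (simp add: algebra_simps)
      ultimately show ?thesis using ** c by linarith
    qed
  qed (use c in auto)
  thus ?thesis by blast
qed

section \<open>Series of differences of inverse squares\<close>

definition wp_term :: "complex \<Rightarrow> complex \<Rightarrow> complex \<Rightarrow> complex \<Rightarrow> int \<times> int \<Rightarrow> complex" where
  "wp_term \<omega>\<^sub>1 \<omega>\<^sub>2 z w p = 1 / (z + lat \<omega>\<^sub>1 \<omega>\<^sub>2 p) ^ 2 - 1 / (w + lat \<omega>\<^sub>1 \<omega>\<^sub>2 p) ^ 2"

text \<open>This is \<open>\<wp>(z) - \<wp>(w)\<close>: the convergence-producing terms of the two Weierstrass series cancel.\<close>

definition wp_diff :: "complex \<Rightarrow> complex \<Rightarrow> complex \<Rightarrow> complex \<Rightarrow> complex" where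
  "wp_diff \<omega>\<^sub>1 \<omega>\<^sub>2 z w = infsum (wp_term \<omega>\<^sub>1 \<omega>\<^sub>2 z w) UNIV"

lemma wp_term_bound:
  assumes "separated A c \<omega>\<^sub>1 \<omega>\<^sub>2 z" "separated A c \<omega>\<^sub>1 \<omega>\<^sub>2 w" "norm (z - w) \<le> B" "p \<in> A"
  shows "norm (wp_term \<omega>\<^sub>1 \<omega>\<^sub>2 z w p) \<le> B * (2 / c ^ 3) * (1 / weight p ^ 3)"
proof -
  have "norm (wp_term \<omega>\<^sub>1 \<omega>\<^sub>2 z w p) \<le> norm (z - w) * (2 / c ^ 3) * (1 / weight p ^ 3)"
    unfolding wp_term_def
    using inverse_square_diff_bound[of c "weight p" "z + lat \<omega>\<^sub>1 \<omega>\<^sub>2 p" "w + lat \<omega>\<^sub>1 \<omega>\<^sub>2 p"] assms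
    by (simp add: separated_def)
  also have "\<dots> \<le> B * (2 / c ^ 3) * (1 / weight p ^ 3)"
    using assms by (intro mult_right_mono) (auto simp: separated_def less_imp_le)
  finally show ?thesis .
qed

lemma summable_on_weight': "(\<lambda>p. K * (1 / weight p ^ 3)) summable_on A"
  by (intro summable_on_cmult_right summable_on_subset_banach[OF summable_on_weight]) auto

lemma wp_term_summable:
  assumes "separated A c \<omega>\<^sub>1 \<omega>\<^sub>2 z" "separated A c' \<omega>\<^sub>1 \<omega>\<^sub>2 w"
  shows "wp_term \<omega>\<^sub>1 \<omega>\<^sub>2 z w summable_on A"
proof -
  have c: "separated A (min c c') \<omega>\<^sub>1 \<omega>\<^sub>2 z" "separated A (min c c') \<omega>\<^sub>1 \<omega>\<^sub>2 w"
    by (rule separated_mono[OF assms(1)] separated_mono[OF assms(2)];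
        use assms in \<open>simp add: separated_def\<close>)+
  show ?thesis
    by (rule abs_summable_summable, rule Infinite_Sum.abs_summable_on_comparison_test'[OF summable_on_weight'])
       (rule wp_term_bound[OF c order_refl])
qed

lemma wp_diff_bound:
  assumes "separated UNIV c \<omega>\<^sub>1 \<omega>\<^sub>2 z" "separated UNIV c \<omega>\<^sub>1 \<omega>\<^sub>2 w"
  shows "norm (wp_diff \<omega>\<^sub>1 \<omega>\<^sub>2 z w) \<le> norm (z - w) * (2 / c ^ 3) * infsum (\<lambda>p. 1 / weight p ^ 3) UNIV"
proof -
  have "norm (wp_diff \<omega>\<^sub>1 \<omega>\<^sub>2 z w) \<le> infsum (\<lambda>p. norm (z - w) * (2 / c ^ 3) * (1 / weight p ^ 3)) UNIV"
    unfolding wp_diff_def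
    by (rule norm_infsum_le[OF has_sum_infsum has_sum_infsum])
       (intro wp_term_summable[OF assms] summable_on_weight' wp_term_bound[OF assms order_refl]; simp)+
  thus ?thesis
    by (simp only: infsum_cmult_right')
qed

text \<open>The M-test with majorant a multiple of \<open>1 / weight p ^ 3\<close> makes the finite
  partial sums converge uniformly, and holomorphy passes to the limit. The periods may vary with
  \<open>t\<close> as well, so that one lemma serves both for fixed lattices and for dependence on
  the modular variable.\<close>

lemma holomorphic_infsum_wp_term:
  assumes S: "open S"
    and hol: "z holomorphic_on S" "w holomorphic_on S" "\<omega>\<^sub>1 holomorphic_on S" "\<omega>\<^sub>2 holomorphic_on S"
    and sep: "\<And>t. t \<in> S \<Longrightarrow> separated A c (\<omega>\<^sub>1 t) (\<omega>\<^sub>2 t) (z t)"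
             "\<And>t. t \<in> S \<Longrightarrow> separated A c (\<omega>\<^sub>1 t) (\<omega>\<^sub>2 t) (w t)"
    and B: "\<And>t. t \<in> S \<Longrightarrow> norm (z t - w t) \<le> B"
  shows "(\<lambda>t. infsum (wp_term (\<omega>\<^sub>1 t) (\<omega>\<^sub>2 t) (z t) (w t)) A) holomorphic_on S"
proof -
  let ?f = "\<lambda>t p. wp_term (\<omega>\<^sub>1 t) (\<omega>\<^sub>2 t) (z t) (w t) p"
  have lim: "uniform_limit S (\<lambda>X t. \<Sum>p\<in>X. ?f t p) (\<lambda>t. infsum (?f t) A) (finite_subsets_at_top A)"
    by (rule Weierstrass_m_test_general[OF _ summable_on_weight'])
       (rule wp_term_bound[OF sep B]; assumption)
  have fin: "(\<lambda>t. \<Sum>p\<in>X. ?f t p) holomorphic_on S" if "X \<subseteq> A" for X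
    unfolding wp_term_def lat_def case_prod_unfold
  proof (intro holomorphic_intros hol)
    fix p t assume "p \<in> X" "t \<in> S"
    with that separatedD[OF sep(1), of t p] separatedD[OF sep(2), of t p]
    show "(z t + (of_int (fst p) * \<omega>\<^sub>1 t + of_int (snd p) * \<omega>\<^sub>2 t))\<^sup>2 \<noteq> 0"
         "(w t + (of_int (fst p) * \<omega>\<^sub>1 t + of_int (snd p) * \<omega>\<^sub>2 t))\<^sup>2 \<noteq> 0"
      by (auto simp: lat_def case_prod_unfold)
  qed
  have "(\<lambda>t. infsum (?f t) A) analytic_on S"
    unfolding analytic_on_def
  proof
    fix t0 assume "t0 \<in> S"
    with S obtain r where r: "r > 0" "cball t0 r \<subseteq> S"
      by (meson open_contains_cball)
    show "\<exists>e>0. (\<lambda>t. infsum (?f t) A) holomorphic_on ball t0 e"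
    proof (rule holomorphic_uniform_limit[of t0 r "\<lambda>X t. \<Sum>p\<in>X. ?f t p" "finite_subsets_at_top A"])
      show "\<forall>\<^sub>F X in finite_subsets_at_top A. continuous_on (cball t0 r) (\<lambda>t. \<Sum>p\<in>X. ?f t p)
              \<and> (\<lambda>t. \<Sum>p\<in>X. ?f t p) holomorphic_on ball t0 r"
      proof (rule eventually_finite_subsets_at_top_weakI)
        fix X assume "finite X" "X \<subseteq> A"
        from fin[OF this(2)] r show "continuous_on (cball t0 r) (\<lambda>t. \<Sum>p\<in>X. ?f t p)
              \<and> (\<lambda>t. \<Sum>p\<in>X. ?f t p) holomorphic_on ball t0 r"
          by (meson ball_subset_cball holomorphic_on_imp_continuous_on holomorphic_on_subset order_trans)
      qed
      show "uniform_limit (cball t0 r) (\<lambda>X t. \<Sum>p\<in>X. ?f t p) (\<lambda>t. infsum (?f t) A) (finite_subsets_at_top A)"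
        by (rule uniform_limit_on_subset[OF lim r(2)])
    qed (use r in \<open>auto simp: finite_subsets_at_top_neq_bot\<close>)
  qed
  thus ?thesis by (rule analytic_imp_holomorphic)
qed

section \<open>Differences of Weierstrass functions\<close>

lemma wp_diff_self [simp]: "wp_diff \<omega>\<^sub>1 \<omega>\<^sub>2 z z = 0"
  by (simp add: wp_diff_def wp_term_def[abs_def])

lemma wp_diff_minus: "wp_diff \<omega>\<^sub>1 \<omega>\<^sub>2 w z = - wp_diff \<omega>\<^sub>1 \<omega>\<^sub>2 z w"
  unfolding wp_diff_def by (subst infsum_uminus[symmetric]) (simp add: wp_term_def[abs_def])

text \<open>A unimodular matrix permutes the index pairs, and the unordered sum is unaffected by
  reindexing.\<close>

lemma wp_diff_change_basis:
  assumes "a * d - b * c = (1 :: int)"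
  shows "wp_diff (of_int a * \<omega>\<^sub>1 + of_int b * \<omega>\<^sub>2) (of_int c * \<omega>\<^sub>1 + of_int d * \<omega>\<^sub>2) z w = wp_diff \<omega>\<^sub>1 \<omega>\<^sub>2 z w"
  unfolding wp_diff_def
proof (rule infsum_reindex_bij_witness[of _ "\<lambda>(m, n). (d * m - c * n, a * n - b * m)"
         "\<lambda>(m, n). (m * a + n * c, m * b + n * d)"], goal_cases)
  case (1 p)
  obtain m n where "p = (m, n)" by (cases p)
  moreover have "d * (m * a + n * c) - c * (m * b + n * d) = (a * d - b * c) * m"
    "a * (m * b + n * d) - b * (m * a + n * c) = (a * d - b * c) * n"
    by (simp_all add: algebra_simps)
  ultimately show ?case using assms by simp
next
  case (3 p)
  obtain m n where "p = (m, n)" by (cases p)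
  moreover have "(d * m - c * n) * a + (a * n - b * m) * c = (a * d - b * c) * m"
    "(d * m - c * n) * b + (a * n - b * m) * d = (a * d - b * c) * n"
    by (simp_all add: algebra_simps)
  ultimately show ?case using assms by simp
next
  case (5 p)
  obtain m n where p: "p = (m, n)" by (cases p)
  have "lat (of_int a * \<omega>\<^sub>1 + of_int b * \<omega>\<^sub>2) (of_int c * \<omega>\<^sub>1 + of_int d * \<omega>\<^sub>2) (m, n)
      = lat \<omega>\<^sub>1 \<omega>\<^sub>2 (m * a + n * c, m * b + n * d)"
    by (simp add: lat_def algebra_simps)
  thus ?case by (simp add: wp_term_def p)
qed auto

lemma wp_diff_swap: "wp_diff \<omega>\<^sub>2 \<omega>\<^sub>1 z w = wp_diff \<omega>\<^sub>1 \<omega>\<^sub>2 z w"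
  unfolding wp_diff_def
  by (rule infsum_reindex_bij_witness[of _ prod.swap prod.swap])
     (auto simp: wp_term_def lat_def add_ac)

text \<open>Homogeneity of degree -2 is the source of the automorphy factor of weight 2.\<close>

lemma wp_diff_scale:
  assumes "t \<noteq> 0"
  shows "wp_diff (t * \<omega>\<^sub>1) (t * \<omega>\<^sub>2) (t * z) (t * w) = wp_diff \<omega>\<^sub>1 \<omega>\<^sub>2 z w / t ^ 2"
proof -
  have "t * x + lat (t * \<omega>\<^sub>1) (t * \<omega>\<^sub>2) p = t * (x + lat \<omega>\<^sub>1 \<omega>\<^sub>2 p)" for x p
    by (simp add: lat_def algebra_simps split: prod.splits)
  hence "wp_term (t * \<omega>\<^sub>1) (t * \<omega>\<^sub>2) (t * z) (t * w) p = (1 / t ^ 2) * wp_term \<omega>\<^sub>1 \<omega>\<^sub>2 z w p" for p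
    by (simp add: wp_term_def power_mult_distrib right_diff_distrib)
  hence "wp_term (t * \<omega>\<^sub>1) (t * \<omega>\<^sub>2) (t * z) (t * w) = (\<lambda>p. (1 / t ^ 2) * wp_term \<omega>\<^sub>1 \<omega>\<^sub>2 z w p)"
    by (rule ext)
  hence "wp_diff (t * \<omega>\<^sub>1) (t * \<omega>\<^sub>2) (t * z) (t * w) = (1 / t ^ 2) * wp_diff \<omega>\<^sub>1 \<omega>\<^sub>2 z w"
    unfolding wp_diff_def by (simp only: infsum_cmult_right')
  thus ?thesis by simp
qed

lemma lat_uminus: "lat \<omega>\<^sub>1 \<omega>\<^sub>2 (- m, - n) = - lat \<omega>\<^sub>1 \<omega>\<^sub>2 (m, n)"
  by (simp add: lat_def)

section \<open>Evenness, periods and the double pole\<close>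

locale lattice =
  fixes \<omega>\<^sub>1 \<omega>\<^sub>2 :: complex
  assumes indep: "Im (\<omega>\<^sub>1 * cnj \<omega>\<^sub>2) \<noteq> 0"
begin

definition off :: "complex \<Rightarrow> bool" where
  "off z \<longleftrightarrow> (\<forall>p. z + lat \<omega>\<^sub>1 \<omega>\<^sub>2 p \<noteq> 0)"

lemma off_separated: "off z \<Longrightarrow> \<exists>c. separated UNIV c \<omega>\<^sub>1 \<omega>\<^sub>2 z"
  by (intro ex_separated indep) (auto simp: off_def)

lemma off_summable: "off z \<Longrightarrow> off w \<Longrightarrow> wp_term \<omega>\<^sub>1 \<omega>\<^sub>2 z w summable_on UNIV"
  using off_separated wp_term_summable by blast

lemma off_uminus: "off z \<Longrightarrow> off (-z)"
  unfolding off_def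
proof
  fix p :: "int \<times> int" assume *: "\<forall>p. z + lat \<omega>\<^sub>1 \<omega>\<^sub>2 p \<noteq> 0"
  obtain m n where p: "p = (m, n)" by (cases p)
  have "z - lat \<omega>\<^sub>1 \<omega>\<^sub>2 p \<noteq> 0" using *[rule_format, of "(-m, -n)"] by (simp add: p lat_uminus)
  thus "- z + lat \<omega>\<^sub>1 \<omega>\<^sub>2 p \<noteq> 0" by auto
qed

lemma off_add:
  assumes "off z" 
  shows "off (z + lat \<omega>\<^sub>1 \<omega>\<^sub>2 q)"
  unfolding off_def
proof
  fix p
  have "z + lat \<omega>\<^sub>1 \<omega>\<^sub>2 q + lat \<omega>\<^sub>1 \<omega>\<^sub>2 p = z + lat \<omega>\<^sub>1 \<omega>\<^sub>2 (fst p + fst q, snd p + snd q)"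
    by (simp add: lat_def algebra_simps split: prod.splits)
  thus "z + lat \<omega>\<^sub>1 \<omega>\<^sub>2 q + lat \<omega>\<^sub>1 \<omega>\<^sub>2 p \<noteq> 0"
    using assms unfolding off_def by metis
qed

lemma wp_diff_add:
  assumes "off z" "off w" "off v"
  shows "wp_diff \<omega>\<^sub>1 \<omega>\<^sub>2 z w + wp_diff \<omega>\<^sub>1 \<omega>\<^sub>2 w v = wp_diff \<omega>\<^sub>1 \<omega>\<^sub>2 z v"
  unfolding wp_diff_def
  by (subst infsum_add[symmetric]) (use assms off_summable in \<open>auto simp: wp_term_def[abs_def]\<close>)

text \<open>Negating the lattice index interchanges the two points, whereas exchanging them changes
  the sign; the value therefore equals its own negative.\<close>

lemma wp_diff_neg_self: "wp_diff \<omega>\<^sub>1 \<omega>\<^sub>2 (-z) z = 0"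
proof -
  have "wp_diff \<omega>\<^sub>1 \<omega>\<^sub>2 (-z) z = wp_diff \<omega>\<^sub>1 \<omega>\<^sub>2 z (-z)"
    unfolding wp_diff_def
  proof (rule infsum_reindex_bij_witness[of _ "\<lambda>(m, n). (-m, -n)" "\<lambda>(m, n). (-m, -n)"], goal_cases)
    case (5 p)
    obtain m n where "p = (m, n)" by (cases p)
    moreover have "(- z + lat \<omega>\<^sub>1 \<omega>\<^sub>2 (m, n))\<^sup>2 = (z - lat \<omega>\<^sub>1 \<omega>\<^sub>2 (m, n))\<^sup>2"
      "(- z - lat \<omega>\<^sub>1 \<omega>\<^sub>2 (m, n))\<^sup>2 = (z + lat \<omega>\<^sub>1 \<omega>\<^sub>2 (m, n))\<^sup>2"
      by (simp_all add: power2_eq_square algebra_simps)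
    ultimately show ?case by (simp add: wp_term_def lat_uminus)
  qed auto
  thus ?thesis using wp_diff_minus[of \<omega>\<^sub>1 \<omega>\<^sub>2 z "-z"] by simp
qed

lemma wp_diff_even:
  assumes "off z" "off w"
  shows "wp_diff \<omega>\<^sub>1 \<omega>\<^sub>2 (-z) w = wp_diff \<omega>\<^sub>1 \<omega>\<^sub>2 z w"
  using wp_diff_add[of "-z" z w] off_uminus assms wp_diff_neg_self by simp

text \<open>Summing over \<open>n\<close> first, each inner sum telescopes; Fubini applies because the double
  series of differences converges absolutely, although the series of the summands does not.\<close>

lemma wp_diff_period2:
  assumes z: "off z"
  shows "wp_diff \<omega>\<^sub>1 \<omega>\<^sub>2 (z + \<omega>\<^sub>2) z = 0"
proof -
  have z': "off (z + \<omega>\<^sub>2)"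
    using off_add[OF z, of "(0, 1)"] by (simp add: lat_def)
  let ?g = "\<lambda>m n. 1 / (z + lat \<omega>\<^sub>1 \<omega>\<^sub>2 (m, n)) ^ 2"
  have inner: "infsum (\<lambda>n. wp_term \<omega>\<^sub>1 \<omega>\<^sub>2 (z + \<omega>\<^sub>2) z (m, n)) UNIV = 0" for m
  proof -
    obtain c where c: "separated UNIV c \<omega>\<^sub>1 \<omega>\<^sub>2 z" using off_separated[OF z] by blast
    hence "c > 0" by (simp add: separated_def)
    have "(\<lambda>n. norm (?g m n)) summable_on UNIV"
    proof (rule Infinite_Sum.abs_summable_on_comparison_test')
      \<comment> \<open>Along a fixed row the terms decay quadratically; the exponent is weakened to
        3/2 to reuse the majorant already known to be summable.\<close>
      show "(\<lambda>n. 1 / c ^ 2 * (1 + \<bar>real_of_int n\<bar>) powr (-3/2)) summable_on UNIV"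
        by (intro summable_on_cmult_right summable_on_int_powr)
      fix n :: int
      have "c * (1 + \<bar>real_of_int n\<bar>) \<le> c * weight (m, n)"
        using \<open>c > 0\<close> by (intro mult_left_mono) (auto simp: weight_def)
      also have "\<dots> \<le> norm (z + lat \<omega>\<^sub>1 \<omega>\<^sub>2 (m, n))"
        using c by (auto simp: separated_def)
      finally have le: "c * (1 + \<bar>real_of_int n\<bar>) \<le> norm (z + lat \<omega>\<^sub>1 \<omega>\<^sub>2 (m, n))" .
      have pos: "c * (1 + \<bar>real_of_int n\<bar>) > 0" using \<open>c > 0\<close> by (intro mult_pos_pos) auto
      have "norm (?g m n) \<le> 1 / (c * (1 + \<bar>real_of_int n\<bar>)) ^ 2"
        unfolding norm_divide norm_power norm_one
        using le pos \<open>c > 0\<close> by (intro divide_left_mono power_mono mult_pos_pos zero_less_power) linarith+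
      also have "\<dots> = 1 / c ^ 2 * (1 + \<bar>real_of_int n\<bar>) powr (-2)"
        by (simp add: powr_minus divide_inverse power_mult_distrib)
      also have "\<dots> \<le> 1 / c ^ 2 * (1 + \<bar>real_of_int n\<bar>) powr (-3/2)"
        by (intro mult_left_mono powr_mono) auto
      finally show "norm (?g m n) \<le> 1 / c ^ 2 * (1 + \<bar>real_of_int n\<bar>) powr (-3/2)" .
    qed
    hence s: "?g m summable_on UNIV" by (rule abs_summable_summable)
    have bij: "bij_betw (\<lambda>n::int. n + 1) UNIV UNIV"
      by (rule bij_betwI[where g = "\<lambda>n. n - 1"]) auto
    have s': "(\<lambda>n. ?g m (n + 1)) summable_on UNIV"
      using s by (subst summable_on_reindex_bij_betw[OF bij])
    have "wp_term \<omega>\<^sub>1 \<omega>\<^sub>2 (z + \<omega>\<^sub>2) z (m, n) = ?g m (n + 1) - ?g m n" for n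
      by (simp add: wp_term_def lat_def algebra_simps)
    hence "infsum (\<lambda>n. wp_term \<omega>\<^sub>1 \<omega>\<^sub>2 (z + \<omega>\<^sub>2) z (m, n)) UNIV
        = infsum (\<lambda>n. ?g m (n + 1)) UNIV - infsum (?g m) UNIV"
      using has_sum_add[OF has_sum_infsum[OF s'] has_sum_uminusI[OF has_sum_infsum[OF s]]]
      by (simp add: infsumI)
    also have "\<dots> = 0"
      using infsum_reindex_bij_betw[OF bij, of "?g m"] by simp
    finally show ?thesis .
  qed
  have "infsum (\<lambda>m. infsum (\<lambda>n. wp_term \<omega>\<^sub>1 \<omega>\<^sub>2 (z + \<omega>\<^sub>2) z (m, n)) UNIV) UNIV
      = infsum (wp_term \<omega>\<^sub>1 \<omega>\<^sub>2 (z + \<omega>\<^sub>2) z) (UNIV \<times> UNIV)"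
    using off_summable[OF z' z] by (intro infsum_Sigma_banach) simp
  thus ?thesis by (simp add: inner wp_diff_def)
qed

end

lemma lattice_swap: "lattice \<omega>\<^sub>1 \<omega>\<^sub>2 \<Longrightarrow> lattice \<omega>\<^sub>2 \<omega>\<^sub>1"
  by (auto simp: lattice_def algebra_simps)

context lattice
begin

lemma wp_diff_period1:
  assumes z: "off z"
  shows "wp_diff \<omega>\<^sub>1 \<omega>\<^sub>2 (z + \<omega>\<^sub>1) z = 0"
proof -
  interpret L': lattice \<omega>\<^sub>2 \<omega>\<^sub>1 
    by (rule lattice_swap) (rule lattice_axioms)
  have "L'.off z"
    unfolding L'.off_def
  proof
    fix p
    show "z + lat \<omega>\<^sub>2 \<omega>\<^sub>1 p \<noteq> 0"
      using z[unfolded off_def, rule_format, of "(snd p, fst p)"]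
      by (auto simp: lat_def add_ac split: prod.splits)
  qed
  thus ?thesis using L'.wp_diff_period2 wp_diff_swap by metis
qed

lemma wp_diff_multiple:
  assumes \<omega>: "\<omega> = \<omega>\<^sub>1 \<or> \<omega> = \<omega>\<^sub>2" and z: "off z"
  shows "off (z + of_int k * \<omega>) \<and> wp_diff \<omega>\<^sub>1 \<omega>\<^sub>2 (z + of_int k * \<omega>) z = 0"
proof -
  have off: "off (y + of_int i * \<omega>)" if "off y" for y and i :: int
    using off_add[OF that, of "(i, 0)"] off_add[OF that, of "(0, i)"] \<omega> by (auto simp: lat_def)
  have step: "wp_diff \<omega>\<^sub>1 \<omega>\<^sub>2 (y + \<omega>) y = 0" if "off y" for y
    using \<omega> wp_diff_period1[OF that] wp_diff_period2[OF that] by auto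
  have "wp_diff \<omega>\<^sub>1 \<omega>\<^sub>2 (z + of_int k * \<omega>) z = 0"
  proof (induction k rule: int_induct[where k = 0])
    case (step1 i)
    show ?case
      using wp_diff_add[OF off[OF z, of "i + 1"] off[OF z, of i] z] step[OF off[OF z, of i]] step1
      by (simp add: algebra_simps)
  next
    case (step2 i)
    show ?case
      using wp_diff_add[OF off[OF z, of "i - 1"] off[OF z, of i] z] step[OF off[OF z, of "i - 1"]] step2
        wp_diff_minus[of \<omega>\<^sub>1 \<omega>\<^sub>2 "z + of_int (i - 1) * \<omega>" "z + of_int i * \<omega>"]
      by (simp add: algebra_simps)
  qed auto
  with off[OF z] show ?thesis by blast
qed

lemma wp_diff_translate:
  assumes z: "off z" and w: "off w"
  shows "wp_diff \<omega>\<^sub>1 \<omega>\<^sub>2 (z + of_int m * \<omega>\<^sub>1 + of_int n * \<omega>\<^sub>2) w = wp_diff \<omega>\<^sub>1 \<omega>\<^sub>2 z w"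
proof -
  have 1: "off (z + of_int m * \<omega>\<^sub>1)" "wp_diff \<omega>\<^sub>1 \<omega>\<^sub>2 (z + of_int m * \<omega>\<^sub>1) z = 0"
    using wp_diff_multiple[OF _ z, of \<omega>\<^sub>1 m] by auto
  have 2: "off (z + of_int m * \<omega>\<^sub>1 + of_int n * \<omega>\<^sub>2)"
    "wp_diff \<omega>\<^sub>1 \<omega>\<^sub>2 (z + of_int m * \<omega>\<^sub>1 + of_int n * \<omega>\<^sub>2) (z + of_int m * \<omega>\<^sub>1) = 0"
    using wp_diff_multiple[OF _ 1(1), of \<omega>\<^sub>2 n] by auto
  show ?thesis
    using wp_diff_add[OF 2(1) 1(1) w] wp_diff_add[OF 1(1) z w] 1 2 by simp
qed

lemma wp_diff_translate_right:
  assumes "off z" "off w"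
  shows "wp_diff \<omega>\<^sub>1 \<omega>\<^sub>2 z (w + of_int m * \<omega>\<^sub>1 + of_int n * \<omega>\<^sub>2) = wp_diff \<omega>\<^sub>1 \<omega>\<^sub>2 z w"
  using wp_diff_translate[OF assms(2,1)] by (metis wp_diff_minus)

lemma wp_diff_holomorphic:
  assumes w: "off w" and S: "open S" "\<And>z. z \<in> S \<Longrightarrow> off z"
  shows "(\<lambda>z. wp_diff \<omega>\<^sub>1 \<omega>\<^sub>2 z w) holomorphic_on S"
proof -
  have "(\<lambda>z. wp_diff \<omega>\<^sub>1 \<omega>\<^sub>2 z w) analytic_on S"
    unfolding analytic_on_def
  proof
    fix z0 assume "z0 \<in> S"
    then obtain c1 c2 where c: "separated UNIV c1 \<omega>\<^sub>1 \<omega>\<^sub>2 z0" "separated UNIV c2 \<omega>\<^sub>1 \<omega>\<^sub>2 w"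
      using S w off_separated by blast
    define c where "c = min (c1 / 2) c2"
    have pos: "c1 > 0" "c2 > 0" "c > 0" using c by (auto simp: separated_def c_def)
    have "(\<lambda>z. infsum (wp_term \<omega>\<^sub>1 \<omega>\<^sub>2 z w) UNIV) holomorphic_on ball z0 (c1 / 2)"
    proof (rule holomorphic_infsum_wp_term[where c = c and B = "norm (z0 - w) + c1 / 2"])
      fix t assume t: "t \<in> ball z0 (c1 / 2)"
      hence "separated UNIV (c1 / 2) \<omega>\<^sub>1 \<omega>\<^sub>2 t"
        by (intro separated_near[OF c(1)]) (auto simp: dist_norm norm_minus_commute)
      thus "separated UNIV c \<omega>\<^sub>1 \<omega>\<^sub>2 t"
        by (rule separated_mono) (use pos in \<open>auto simp: c_def\<close>)
      show "separated UNIV c \<omega>\<^sub>1 \<omega>\<^sub>2 w"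
        by (rule separated_mono[OF c(2)]) (use pos in \<open>auto simp: c_def\<close>)
      show "norm (t - w) \<le> norm (z0 - w) + c1 / 2"
        using norm_triangle_ineq[of "z0 - w" "t - z0"] t by (auto simp: dist_norm norm_minus_commute)
    qed auto
    thus "\<exists>e>0. (\<lambda>z. wp_diff \<omega>\<^sub>1 \<omega>\<^sub>2 z w) holomorphic_on ball z0 e"
      using pos by (intro exI[of _ "c1 / 2"]) (auto simp: wp_diff_def)
  qed
  thus ?thesis by (rule analytic_imp_holomorphic)
qed

lemma lat_eq_0_iff: "lat \<omega>\<^sub>1 \<omega>\<^sub>2 p = 0 \<longleftrightarrow> p = (0, 0)"
proof
  assume "lat \<omega>\<^sub>1 \<omega>\<^sub>2 p = 0"
  hence "\<bar>real_of_int (fst p)\<bar> + \<bar>real_of_int (snd p)\<bar> \<le> 0"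
    using lattice_lower_bound[of \<omega>\<^sub>1 \<omega>\<^sub>2 "of_int (fst p)" "of_int (snd p)"] indep
    by (auto simp: lat_def mult_le_0_iff split: prod.splits)
  thus "p = (0, 0)" by (cases p) auto
qed (auto simp: lat_def)

text \<open>Only the term of index (0, 0) is singular at 0, and it contributes 1/z^2 - 1/w^2. The
  sum over all other indices is holomorphic near 0 and is killed by the factor z^2.\<close>

lemma wp_diff_pole:
  assumes w: "off w"
  shows "((\<lambda>z. z ^ 2 * wp_diff \<omega>\<^sub>1 \<omega>\<^sub>2 z w) \<longlongrightarrow> 1) (at 0)"
proof -
  define A where "A = (UNIV - {(0, 0)} :: (int \<times> int) set)"
  obtain c1 where c1: "separated A c1 \<omega>\<^sub>1 \<omega>\<^sub>2 0"
    using ex_separated[OF indep, of A 0] lat_eq_0_iff by (auto simp: A_def)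
  obtain c2 where c2': "separated UNIV c2 \<omega>\<^sub>1 \<omega>\<^sub>2 w"
    using w off_separated by blast
  hence c2: "separated A c2 \<omega>\<^sub>1 \<omega>\<^sub>2 w" by (auto simp: separated_def)
  define c where "c = min (c1 / 2) c2"
  have pos: "c1 > 0" "c2 > 0" "c > 0" using c1 c2 by (auto simp: separated_def c_def)
  have sep: "separated A c \<omega>\<^sub>1 \<omega>\<^sub>2 t" if "t \<in> ball 0 (c1 / 2)" for t
    using that pos by (intro separated_mono[OF separated_near[OF c1]]) (auto simp: c_def dist_norm)
  have sepw: "separated A c \<omega>\<^sub>1 \<omega>\<^sub>2 w"
    by (rule separated_mono[OF c2]) (use pos in \<open>auto simp: c_def\<close>)
  define R where "R = (\<lambda>z. infsum (wp_term \<omega>\<^sub>1 \<omega>\<^sub>2 z w) A)"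
  have "R holomorphic_on ball 0 (c1 / 2)"
    unfolding R_def
  proof (rule holomorphic_infsum_wp_term[where c = c and B = "norm w + c1 / 2"])
    fix t :: complex assume t: "t \<in> ball 0 (c1 / 2)"
    show "norm (t - w) \<le> norm w + c1 / 2"
      using norm_triangle_ineq4[of t w] t by (auto simp: dist_norm)
  qed (use sep sepw in auto)
  hence "continuous_on (ball 0 (c1 / 2)) R" by (rule holomorphic_on_imp_continuous_on)
  hence R: "isCont R 0" using pos by (simp add: continuous_on_eq_continuous_at)
  have "((\<lambda>z. 1 - z ^ 2 / w ^ 2 + z ^ 2 * R z) \<longlongrightarrow> 1 - 0 ^ 2 / w ^ 2 + 0 ^ 2 * R 0) (at 0)"
    using R w[unfolded off_def, rule_format, of "(0, 0)"]
    by (intro tendsto_intros) (auto simp: isCont_def lat_def)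
  moreover have "eventually (\<lambda>z. 1 - z ^ 2 / w ^ 2 + z ^ 2 * R z = z ^ 2 * wp_diff \<omega>\<^sub>1 \<omega>\<^sub>2 z w) (at 0)"
  proof -
    have "eventually (\<lambda>z. z \<in> ball 0 (c1 / 2) - {0}) (at 0)"
      using pos by (intro eventually_at_in_open) auto
    thus ?thesis
    proof eventually_elim
      case (elim z)
      have "wp_diff \<omega>\<^sub>1 \<omega>\<^sub>2 z w = infsum (wp_term \<omega>\<^sub>1 \<omega>\<^sub>2 z w) (insert (0, 0) A)"
        by (simp add: wp_diff_def A_def insert_UNIV)
      also have "\<dots> = wp_term \<omega>\<^sub>1 \<omega>\<^sub>2 z w (0, 0) + R z"
        unfolding R_def using elim sep[of z] sepw
        by (intro infsum_insert wp_term_summable) (auto simp: A_def)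
      finally show ?case using elim by (simp add: wp_term_def lat_def field_simps)
    qed
  qed
  ultimately show ?thesis by (auto dest: Lim_transform_eventually)
qed

end

section \<open>Theta products\<close>

lemma qq_add: "qq (z + w) = qq z * qq w"
  by (simp add: qq_def exp_add ring_distribs)

lemma qq_minus: "qq (- z) = 1 / qq z"
  by (simp add: qq_def exp_minus field_simps)

lemma qq_diff: "qq (z - w) = qq z / qq w"
  using qq_add[of z "-w"] by (simp add: qq_minus)

lemma qq_nonzero [simp]: "qq z \<noteq> 0"
  by (simp add: qq_def)

lemma qq_of_nat_mult: "qq (of_nat n * z) = qq z ^ n"
  by (simp add: qq_def exp_of_nat_mult[symmetric] mult_ac)

lemma qq_0 [simp]: "qq 0 = 1"
  by (simp add: qq_def)

lemma qq_1 [simp]: "qq 1 = 1"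
  by (simp add: qq_def)

lemma norm_qq: "norm (qq z) = exp (- 2 * pi * Im z)"
  by (simp add: qq_def)

lemma norm_qq_less_1: "Im z > 0 \<Longrightarrow> norm (qq z) < 1"
  by (simp add: norm_qq)

lemma qq_eq_1D:
  assumes "qq z = 1"
  shows "\<exists>n::int. z = of_int n"
proof -
  from assms obtain n :: int where "Re (2 * of_real pi * \<i> * z) = 0"
    "Im (2 * of_real pi * \<i> * z) = of_int (2 * n) * pi"
    unfolding qq_def exp_eq_1 by blast
  hence "Im z = 0" "Re z = of_int n" by auto
  thus ?thesis by (intro exI[of _ n]) (auto simp: complex_eq_iff)
qed

lemma qq_holomorphic [holomorphic_intros]: "f holomorphic_on A \<Longrightarrow> (\<lambda>z. qq (f z)) holomorphic_on A"
  unfolding qq_def by (intro holomorphic_intros)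

section \<open>The infinite product as an entire function of its first argument\<close>

context
  fixes q :: complex
  assumes q: "norm q < 1"
begin

lemma convergent_prod_qpochinf: "convergent_prod (\<lambda>n. 1 - a * q ^ n)"
proof (rule abs_convergent_prod_imp_convergent_prod)
  have "summable (\<lambda>n. norm a * norm q ^ n)"
    using q by (intro summable_mult summable_geometric) auto
  thus "abs_convergent_prod (\<lambda>n. 1 - a * q ^ n)"
    by (simp add: abs_convergent_prod_conv_summable norm_mult norm_power)
qed

lemma qpochinf_step: "qpochinf a q = (1 - a) * qpochinf (a * q) q"
  using has_prod_unique[OF has_prod_ignore_initial_segment'[OF convergent_prod_qpochinf[of a], of 1]]
  by (simp add: qpochinf_def mult_ac)

lemma qpochinf_nonzero:
  assumes "\<And>n. a * q ^ n \<noteq> 1"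
  shows "qpochinf a q \<noteq> 0"
  unfolding qpochinf_def
  by (intro prodinf_nonzero convergent_prod_qpochinf) (use assms in \<open>metis eq_iff_diff_eq_0\<close>)

text \<open>On each closed unit disc the deviations of the factors from 1 are dominated by a
  geometric series, so the partial products converge uniformly there.\<close>

lemma qpochinf_holomorphic_UNIV: "(\<lambda>a. qpochinf a q) holomorphic_on UNIV"
proof -
  have "(\<lambda>a. qpochinf a q) analytic_on UNIV"
    unfolding analytic_on_def
  proof
    fix a0 :: complex
    let ?K = "cball a0 1"
    have "uniformly_convergent_on ?K (\<lambda>N a. \<Prod>n<N. 1 - a * q ^ n)"
    proof (rule uniformly_convergent_on_prod')
      have "uniformly_convergent_on ?K (\<lambda>N a. \<Sum>n<N. norm (a * q ^ n))"
      proof (rule Weierstrass_m_test')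
        show "summable (\<lambda>n. (norm a0 + 1) * norm q ^ n)"
          using q by (intro summable_mult summable_geometric) auto
        fix n a assume "a \<in> ?K"
        hence "norm a \<le> norm a0 + 1"
          using norm_triangle_ineq[of a0 "a - a0"] by (auto simp: dist_norm norm_minus_commute)
        thus "norm (norm (a * q ^ n)) \<le> (norm a0 + 1) * norm q ^ n"
          by (auto simp: norm_mult norm_power intro!: mult_right_mono)
      qed
      thus "uniformly_convergent_on ?K (\<lambda>N a. \<Sum>n<N. norm (1 - a * q ^ n - 1))" by simp
    qed (auto intro!: continuous_intros)
    then obtain l where l: "uniform_limit ?K (\<lambda>N a. \<Prod>n<N. 1 - a * q ^ n) l sequentially"
      by (auto simp: uniformly_convergent_on_def)
    have "l a = qpochinf a q" if "a \<in> ?K" for a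
    proof (rule LIMSEQ_unique)
      show "(\<lambda>N. \<Prod>n<N. 1 - a * q ^ n) \<longlonglongrightarrow> l a"
        by (rule tendsto_uniform_limitI[OF l that])
      show "(\<lambda>N. \<Prod>n<N. 1 - a * q ^ n) \<longlonglongrightarrow> qpochinf a q"
        using convergent_prod_LIMSEQ[OF convergent_prod_qpochinf[of a]]
        unfolding qpochinf_def LIMSEQ_lessThan_iff_atMost .
    qed
    hence "uniform_limit ?K (\<lambda>N a. \<Prod>n<N. 1 - a * q ^ n) (\<lambda>a. qpochinf a q) sequentially"
      using l by (subst uniform_limit_cong'[where g = "\<lambda>N a. \<Prod>n<N. 1 - a * q ^ n" and i = l]) auto
    thus "\<exists>e>0. (\<lambda>a. qpochinf a q) holomorphic_on ball a0 e"
      by (rule holomorphic_uniform_limit[rotated])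
         (auto intro!: always_eventually continuous_intros holomorphic_intros exI[of _ 1])
  qed
  thus ?thesis by (rule analytic_imp_holomorphic)
qed

lemma qpochinf_holomorphic: "f holomorphic_on A \<Longrightarrow> (\<lambda>z. qpochinf (f z) q) holomorphic_on A"
  using holomorphic_on_compose_gen[OF _ qpochinf_holomorphic_UNIV, of f A] by (simp add: o_def)

end

text \<open>Up to a constant depending on \<open>\<omega>\<close> and the factor exp(-pi i z), this
  is the odd Jacobi theta function in product form.\<close>

definition theta :: "complex \<Rightarrow> complex \<Rightarrow> complex" where
  "theta \<omega> z = qpochinf (qq z) (qq \<omega>) * qpochinf (qq \<omega> / qq z) (qq \<omega>)"

locale theta_lattice =
  fixes \<omega> :: complex
  assumes Im_pos: "Im \<omega> > 0"

sublocale theta_lattice \<subseteq> lattice \<omega> 1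
  by unfold_locales (use Im_pos in auto)

context theta_lattice
begin

lemmas q_less_1 = norm_qq_less_1[OF Im_pos]

lemma theta_holomorphic [holomorphic_intros]:
  "f holomorphic_on A \<Longrightarrow> (\<lambda>z. theta \<omega> (f z)) holomorphic_on A"
  unfolding theta_def by (intro holomorphic_intros qpochinf_holomorphic[OF q_less_1]) auto

lemma theta_isCont: "isCont (theta \<omega>) z"
proof -
  have "(\<lambda>z. theta \<omega> z) holomorphic_on UNIV" by (intro holomorphic_intros)
  thus ?thesis
    by (auto dest!: holomorphic_on_imp_continuous_on simp: continuous_on_eq_continuous_at)
qed

lemma theta_tendsto: "(f \<longlongrightarrow> l) F \<Longrightarrow> ((\<lambda>x. theta \<omega> (f x)) \<longlongrightarrow> theta \<omega> l) F"
  using isCont_tendsto_compose[OF theta_isCont] .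

lemma theta_plus_1: "theta \<omega> (z + 1) = theta \<omega> z"
  by (simp add: theta_def qq_add)

text \<open>The shift removes the factor \<open>1 - qq z\<close> from the first product and adds
  \<open>1 - 1 / qq z\<close> to the second; the quotient of the two is
  \<open>- 1 / qq z\<close>.\<close>

lemma theta_plus_omega: "theta \<omega> (z + \<omega>) = - theta \<omega> z / qq z"
proof -
  have "qpochinf (1 / qq z) (qq \<omega>) = (1 - 1 / qq z) * qpochinf (qq \<omega> / qq z) (qq \<omega>)"
    by (subst qpochinf_step[OF q_less_1]) simp
  moreover have "qpochinf (qq z) (qq \<omega>) = (1 - qq z) * qpochinf (qq z * qq \<omega>) (qq \<omega>)"
    by (rule qpochinf_step[OF q_less_1])
  moreover have "theta \<omega> (z + \<omega>) = qpochinf (qq z * qq \<omega>) (qq \<omega>) * qpochinf (1 / qq z) (qq \<omega>)"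
    by (simp add: theta_def qq_add)
  ultimately have "theta \<omega> (z + \<omega>) = qpochinf (qq z * qq \<omega>) (qq \<omega>)
      * ((1 - 1 / qq z) * qpochinf (qq \<omega> / qq z) (qq \<omega>))"
    "theta \<omega> z = (1 - qq z) * qpochinf (qq z * qq \<omega>) (qq \<omega>) * qpochinf (qq \<omega> / qq z) (qq \<omega>)"
    unfolding theta_def[of \<omega> z] by simp_all
  thus ?thesis by (simp add: divide_simps) (simp add: algebra_simps)
qed

lemma theta_uminus: "theta \<omega> (- z) = - theta \<omega> z / qq z"
proof -
  have "theta \<omega> (- z) = theta \<omega> (z + \<omega>)"
    by (simp add: theta_def qq_add qq_minus mult_ac)
  thus ?thesis by (simp only: theta_plus_omega)
qed

lemma theta_reflect: "theta \<omega> (\<omega> - z) = theta \<omega> z"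
  by (simp add: theta_def qq_diff mult_ac)

lemma theta_nonzero:
  assumes "off z"
  shows "theta \<omega> z \<noteq> 0"
proof -
  have "qq z * qq \<omega> ^ n \<noteq> 1" for n
  proof
    assume "qq z * qq \<omega> ^ n = 1"
    hence "qq (z + of_nat n * \<omega>) = 1" by (simp add: qq_add qq_of_nat_mult)
    then obtain k :: int where "z + of_nat n * \<omega> = of_int k" using qq_eq_1D by blast
    hence "z + lat \<omega> 1 (int n, -k) = 0" by (simp add: lat_def algebra_simps)
    thus False using assms unfolding off_def by blast
  qed
  moreover have "qq \<omega> / qq z * qq \<omega> ^ n \<noteq> 1" for n
  proof
    assume "qq \<omega> / qq z * qq \<omega> ^ n = 1"
    hence "qq (of_nat (Suc n) * \<omega> - z) = 1" unfolding qq_diff qq_of_nat_mult by simp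
    then obtain k :: int where "of_nat (Suc n) * \<omega> - z = of_int k" using qq_eq_1D by blast
    hence "z + lat \<omega> 1 (- int (Suc n), k) = 0" by (simp add: lat_def algebra_simps)
    thus False using assms unfolding off_def by blast
  qed
  ultimately show ?thesis
    unfolding theta_def mult_eq_0_iff
    by (metis qpochinf_nonzero[OF q_less_1, of "qq z"] qpochinf_nonzero[OF q_less_1, of "qq \<omega> / qq z"])
qed

text \<open>The derivative of \<open>theta\<close> at its zero 0, given in closed form so that its
  nonvanishing can be read off.\<close>

definition theta_deriv :: complex where
  "theta_deriv = - (2 * of_real pi * \<i>) * qpochinf (qq \<omega>) (qq \<omega>) ^ 2"

lemma theta_deriv_nonzero: "theta_deriv \<noteq> 0"
proof -
  have "qq \<omega> * qq \<omega> ^ n \<noteq> 1" for n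
  proof
    assume "qq \<omega> * qq \<omega> ^ n = 1"
    hence "norm (qq \<omega>) ^ Suc n = 1" by (metis norm_one norm_power power_Suc)
    moreover have "norm (qq \<omega>) ^ Suc n < 1" using q_less_1 by (intro power_Suc_less_one) auto
    ultimately show False by simp
  qed
  thus ?thesis by (auto simp: theta_deriv_def qpochinf_nonzero[OF q_less_1])
qed

text \<open>The zero at 0 comes from the single factor \<open>1 - qq z\<close>, which is split off;
  the remaining product \<open>?G\<close> is continuous at 0.\<close>

lemma theta_over_z_tendsto: "((\<lambda>z. theta \<omega> z / z) \<longlongrightarrow> theta_deriv) (at 0)"
proof -
  let ?G = "\<lambda>z. qpochinf (qq z * qq \<omega>) (qq \<omega>) * qpochinf (qq \<omega> / qq z) (qq \<omega>)"
  have "?G holomorphic_on UNIV"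
    by (intro holomorphic_intros qpochinf_holomorphic[OF q_less_1]) auto
  hence "isCont ?G 0"
    by (auto dest!: holomorphic_on_imp_continuous_on simp: continuous_on_eq_continuous_at)
  hence G: "(?G \<longlongrightarrow> ?G 0) (at 0)" by (simp add: isCont_def)
  have "((\<lambda>z. 1 - qq z) has_field_derivative - (2 * of_real pi * \<i>)) (at 0)"
    unfolding qq_def by (auto intro!: derivative_eq_intros)
  hence "((\<lambda>z. (1 - qq z) / z) \<longlongrightarrow> - (2 * of_real pi * \<i>)) (at 0)"
    by (simp add: has_field_derivative_iff)
  from tendsto_mult[OF this G]
  have "((\<lambda>z. (1 - qq z) / z * ?G z) \<longlongrightarrow> theta_deriv) (at 0)"
    by (simp add: theta_deriv_def power2_eq_square)
  moreover have "(1 - qq z) / z * ?G z = theta \<omega> z / z" for z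
    unfolding theta_def by (subst (3) qpochinf_step[OF q_less_1]) simp
  ultimately show ?thesis by (simp only:)
qed

end

section \<open>The product formula\<close>

text \<open>The codomain of \<open>h\<close> is arbitrary: the lemma is applied to a complex
  function and also to the map sending a point to its set of limits.\<close>

lemma periodic_lat:
  assumes "\<And>z. h (z + \<omega>\<^sub>1) = h z" "\<And>z. h (z + \<omega>\<^sub>2) = h z"
  shows "h (z + lat \<omega>\<^sub>1 \<omega>\<^sub>2 p) = h z"
proof -
  have mult: "h (z + of_int k * \<omega>) = h z" if "\<And>z. h (z + \<omega>) = h z" for k z \<omega>
  proof (induction k rule: int_induct[where k = 0])
    case (step1 i)
    thus ?case using that[of "z + of_int i * \<omega>"] by (simp add: algebra_simps)
  next
    case (step2 i)
    thus ?case using that[of "z + of_int (i - 1) * \<omega>"] by (simp add: algebra_simps)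
  qed auto
  show ?thesis
    using mult[OF assms(1), of z "fst p"] mult[OF assms(2), of "z + of_int (fst p) * \<omega>\<^sub>1" "snd p"]
    by (simp add: lat_def add_ac case_prod_unfold)
qed

text \<open>Periodicity is asked for only near the point, since the quotient studied below is known
  to be periodic only away from its singularities.\<close>

lemma tendsto_at_translate:
  fixes f :: "complex \<Rightarrow> complex"
  assumes "eventually (\<lambda>z. f (z + d) = f z) (at z0)"
  shows "(f \<longlongrightarrow> l) (at (z0 + d)) \<longleftrightarrow> (f \<longlongrightarrow> l) (at z0)"
proof -
  have "at (z0 + d) = filtermap (\<lambda>z. z + d) (at z0)"
    using filtermap_at_shift[of "-d" z0] by simp
  hence "(f \<longlongrightarrow> l) (at (z0 + d)) \<longleftrightarrow> ((\<lambda>z. f (z + d)) \<longlongrightarrow> l) (at z0)"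
    by (simp add: filterlim_filtermap)
  also have "\<dots> \<longleftrightarrow> (f \<longlongrightarrow> l) (at z0)"
    by (rule tendsto_cong[OF assms])
  finally show ?thesis .
qed

context lattice
begin

text \<open>Discreteness of the lattice: indices that miss \<open>z0\<close> stay separated from all
  nearby points, and an index that hits \<open>z0\<close> can hit no other point.\<close>

lemma eventually_off: "eventually off (at z0)"
proof -
  obtain c where c: "separated {p. z0 + lat \<omega>\<^sub>1 \<omega>\<^sub>2 p \<noteq> 0} c \<omega>\<^sub>1 \<omega>\<^sub>2 z0"
    using ex_separated[OF indep, of "{p. z0 + lat \<omega>\<^sub>1 \<omega>\<^sub>2 p \<noteq> 0}" z0] by auto
  have "eventually (\<lambda>z. z \<in> ball z0 (c / 2) - {z0}) (at z0)"
    using c by (intro eventually_at_in_open) (auto simp: separated_def)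
  thus ?thesis
  proof eventually_elim
    case (elim z)
    hence "separated {p. z0 + lat \<omega>\<^sub>1 \<omega>\<^sub>2 p \<noteq> 0} (c / 2) \<omega>\<^sub>1 \<omega>\<^sub>2 z"
      by (intro separated_near[OF c]) (auto simp: dist_norm norm_minus_commute)
    hence "z + lat \<omega>\<^sub>1 \<omega>\<^sub>2 p \<noteq> 0" if "z0 + lat \<omega>\<^sub>1 \<omega>\<^sub>2 p \<noteq> 0" for p
      using separatedD that by blast
    moreover have "z + lat \<omega>\<^sub>1 \<omega>\<^sub>2 p \<noteq> 0" if "z0 + lat \<omega>\<^sub>1 \<omega>\<^sub>2 p = 0" for p
      using that elim by (auto simp: add_eq_0_iff2)
    ultimately show ?case unfolding off_def by blast
  qed
qed

lemma open_off: "open {z. off z}"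
proof (rule openI)
  fix z0 assume "z0 \<in> {z. off z}"
  then obtain c where c: "separated UNIV c \<omega>\<^sub>1 \<omega>\<^sub>2 z0" using off_separated by blast
  have "ball z0 (c / 2) \<subseteq> {z. off z}"
  proof safe
    fix z assume "z \<in> ball z0 (c / 2)"
    hence "separated UNIV (c / 2) \<omega>\<^sub>1 \<omega>\<^sub>2 z"
      by (intro separated_near[OF c]) (auto simp: dist_norm norm_minus_commute)
    thus "off z" unfolding off_def using separatedD by blast
  qed
  thus "\<exists>T>0. ball z0 T \<subseteq> {z. off z}"
    using c by (intro exI[of _ "c / 2"]) (auto simp: separated_def)
qed

lemma not_offE:
  assumes "\<not> off z"
  obtains p where "z = lat \<omega>\<^sub>1 \<omega>\<^sub>2 p"
proof -
  from assms obtain m n where "z + lat \<omega>\<^sub>1 \<omega>\<^sub>2 (m, n) = 0" by (auto simp: off_def)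
  hence "z = lat \<omega>\<^sub>1 \<omega>\<^sub>2 (-m, -n)" by (simp add: lat_uminus add_eq_0_iff2)
  thus ?thesis by (rule that)
qed

end

lemma eventually_at_translate: "eventually P (at (z + d)) \<longleftrightarrow> eventually (\<lambda>x. P (x + d)) (at (z :: complex))"
proof -
  have "at (z + d) = filtermap (\<lambda>z. z + d) (at z)"
    using filtermap_at_shift[of "-d" z] by simp
  thus ?thesis by (simp add: eventually_filtermap)
qed

context theta_lattice
begin

text \<open>Replacing both real coordinates by their fractional parts shows that every value is
  taken on the compact fundamental parallelogram.\<close>

lemma doubly_periodic_bounded:
  assumes cont: "continuous_on UNIV (g :: complex \<Rightarrow> complex)"
    and per: "\<And>z. g (z + \<omega>) = g z" "\<And>z. g (z + 1) = g z"
  shows "bounded (range g)"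
proof -
  define K where "K = (\<lambda>(x, y). of_real x * \<omega> + of_real y) ` ({0..1::real} \<times> {0..1::real})"
  have "compact K"
    unfolding K_def by (intro compact_continuous_image compact_Times)
      (auto simp: case_prod_unfold intro!: continuous_intros)
  hence "bounded (g ` K)"
    using cont by (intro compact_imp_bounded compact_continuous_image) (auto intro: continuous_on_subset)
  moreover have "range g \<subseteq> g ` K"
  proof
    fix u assume "u \<in> range g"
    then obtain z where u: "u = g z" by auto
    define x where "x = Im z / Im \<omega>"
    define y where "y = Re z - x * Re \<omega>"
    have z: "z = of_real x * \<omega> + of_real y"
      using Im_pos by (auto simp: complex_eq_iff x_def y_def)
    have "g (of_real (frac x) * \<omega> + of_real (frac y)) = g z"
    proof -
      have "z = of_real (frac x) * \<omega> + of_real (frac y) + lat \<omega> 1 (\<lfloor>x\<rfloor>, \<lfloor>y\<rfloor>)"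
        by (subst z) (simp add: lat_def frac_def algebra_simps)
      thus ?thesis using periodic_lat[of g \<omega> 1, OF per] by metis
    qed
    moreover have "of_real (frac x) * \<omega> + of_real (frac y) \<in> K"
      unfolding K_def by (rule image_eqI[of _ _ "(frac x, frac y)"]) (auto simp: frac_lt_1 less_imp_le)
    ultimately show "u \<in> g ` K" unfolding u by (metis image_eqI)
  qed
  ultimately show ?thesis by (rule bounded_subset)
qed

text \<open>The quotient \<open>f\<close> of the two sides, up to a constant, is doubly periodic.
  The zeros of \<open>theta\<close> cancel the double pole at 0, and the zeros of
  \<open>wp_diff\<close> at w and -w cancel those of the denominator; \<open>off (w + w)\<close>
  ensures that only one denominator factor vanishes at w. Liouville's theorem makes \<open>f\<close>
  constant, and its limit at 0 gives the constant.\<close>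

theorem wp_diff_eq_theta:
  assumes w: "off w" "off (w + w)" and z: "off z" "off (z + w)" "off (z - w)"
  shows "wp_diff \<omega> 1 z w = - (theta_deriv ^ 2) * qq w * theta \<omega> (z + w) * theta \<omega> (z - w)
           / (theta \<omega> z ^ 2 * theta \<omega> w ^ 2)"
proof -
  define f where "f = (\<lambda>z. wp_diff \<omega> 1 z w * theta \<omega> z ^ 2 / (theta \<omega> (z + w) * theta \<omega> (z - w)))"
  define S where "S = {z. off z \<and> off (z + w) \<and> off (z - w)}"
  have "open S"
  proof -
    have "S = {z. off z} \<inter> (\<lambda>z. z + w) -` {z. off z} \<inter> (\<lambda>z. z - w) -` {z. off z}"
      by (auto simp: S_def)
    also have "open \<dots>"
      by (intro open_Int open_off open_vimage continuous_intros)
    finally show ?thesis .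
  qed
  have f_hol: "f holomorphic_on S"
    unfolding f_def using \<open>open S\<close> w
    by (intro holomorphic_intros wp_diff_holomorphic) (auto simp: S_def theta_nonzero)
  have ev: "eventually (\<lambda>z. z \<in> S) (at z0)" for z0
  proof -
    have "eventually (\<lambda>z. off (z + w)) (at z0)" "eventually (\<lambda>z. off (z - w)) (at z0)"
      using eventually_off[of "z0 + w"] eventually_off[of "z0 - w"]
        eventually_at_translate[of off z0 w] eventually_at_translate[of off z0 "-w"] by auto
    with eventually_off[of z0] show ?thesis
      unfolding S_def mem_Collect_eq by eventually_elim auto
  qed
  have f_1: "f (z + 1) = f z" if "z \<in> S" for z
  proof -
    have "wp_diff \<omega> 1 (z + 1) w = wp_diff \<omega> 1 z w"
      using wp_diff_translate[of z w 0 1] that w by (auto simp: S_def)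
    moreover have "z + 1 + w = (z + w) + 1" "z + 1 - w = (z - w) + 1" by simp_all
    ultimately show ?thesis by (simp only: f_def theta_plus_1)
  qed
  have f_\<omega>: "f (z + \<omega>) = f z" if "z \<in> S" for z
  proof -
    have 1: "wp_diff \<omega> 1 (z + \<omega>) w = wp_diff \<omega> 1 z w"
      using wp_diff_translate[of z w 1 0] that w by (auto simp: S_def)
    have 2: "z + \<omega> + w = (z + w) + \<omega>" "z + \<omega> - w = (z - w) + \<omega>" by simp_all
    \<comment> \<open>The square in the numerator picks up \<open>1 / qq z ^ 2\<close>; in the
      denominator the factors \<open>qq w\<close> and \<open>1 / qq w\<close> cancel and leave the
      same multiplier.\<close>
    show ?thesis
      unfolding f_def 1 2 theta_plus_omega qq_add qq_diff
      using that by (simp add: S_def theta_nonzero field_simps power2_eq_square)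
  qed
  have f_even: "f (- z) = f z" if "z \<in> S" for z
  proof -
    have 1: "wp_diff \<omega> 1 (- z) w = wp_diff \<omega> 1 z w"
      using wp_diff_even[of z w] that w by (auto simp: S_def)
    have 2: "- z + w = - (z - w)" "- z - w = - (z + w)" by simp_all
    show ?thesis
      unfolding f_def 1 2 theta_uminus qq_add qq_diff
      using that by (simp add: S_def theta_nonzero field_simps power2_eq_square)
  qed
  \<comment> \<open>Removability of a singularity becomes nonemptiness of this set of limits. As
    \<open>h\<close> is invariant under the lattice, besides the points of \<open>S\<close> only 0,
    w and -w have to be examined.\<close>
  define h where "h = (\<lambda>z0. {l. (f \<longlongrightarrow> l) (at z0)})"
  have h_1: "h (z0 + 1) = h z0" for z0
    unfolding h_def using tendsto_at_translate[of f 1 z0] eventually_mono[OF ev[of z0] f_1] by simp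
  have h_\<omega>: "h (z0 + \<omega>) = h z0" for z0
    unfolding h_def using tendsto_at_translate[of f \<omega> z0] eventually_mono[OF ev[of z0] f_\<omega>] by simp
  have h_lat: "h (z0 + lat \<omega> 1 p) = h z0" for z0 p
    by (rule periodic_lat[of h, OF h_\<omega> h_1])

  \<comment> \<open>At 0 the double pole against the squared simple zero gives
    \<open>theta_deriv ^ 2\<close>, and the denominator tends to
    \<open>theta \<omega> w * theta \<omega> (- w)\<close>, that is,
    \<open>- (theta \<omega> w ^ 2) / qq w\<close>.\<close>
  define C where "C = - (theta_deriv ^ 2) * qq w / theta \<omega> w ^ 2"
  have lim_0: "C \<in> h 0"
  proof -
    have "((\<lambda>z. (z ^ 2 * wp_diff \<omega> 1 z w) * (theta \<omega> z / z) ^ 2 / (theta \<omega> (z + w) * theta \<omega> (z - w)))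
        \<longlongrightarrow> 1 * theta_deriv ^ 2 / (theta \<omega> (0 + w) * theta \<omega> (0 - w))) (at 0)"
      using theta_nonzero[OF w(1)]
      by (intro tendsto_intros wp_diff_pole w theta_over_z_tendsto theta_tendsto) (simp add: theta_uminus)
    moreover have "1 * theta_deriv ^ 2 / (theta \<omega> (0 + w) * theta \<omega> (0 - w)) = C"
      by (simp add: C_def theta_uminus power2_eq_square)
    moreover have "eventually (\<lambda>z. (z ^ 2 * wp_diff \<omega> 1 z w) * (theta \<omega> z / z) ^ 2
        / (theta \<omega> (z + w) * theta \<omega> (z - w)) = f z) (at 0)"
      using eventually_neq_at_within[of 0] by eventually_elim (simp add: f_def power_divide)
    ultimately show ?thesis by (auto simp: h_def dest: Lim_transform_eventually)
  qed
  have lim_w: "h w \<noteq> {}"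
  proof -
    \<comment> \<open>Both \<open>wp_diff\<close> and \<open>theta \<omega> (z - w)\<close> vanish
      at w, so each is divided by \<open>z - w\<close> and the limit is taken of the resulting
      difference quotients.\<close>
    have "(\<lambda>z. wp_diff \<omega> 1 z w) holomorphic_on {z. off z}"
      using w by (intro wp_diff_holomorphic open_off) auto
    then obtain D where "((\<lambda>z. wp_diff \<omega> 1 z w) has_field_derivative D) (at w)"
      using open_off w(1) by (auto simp: holomorphic_on_open)
    hence D: "((\<lambda>z. wp_diff \<omega> 1 z w / (z - w)) \<longlongrightarrow> D) (at w)"
      by (simp add: has_field_derivative_iff)
    have th: "((\<lambda>z. theta \<omega> (z - w) / (z - w)) \<longlongrightarrow> theta_deriv) (at w)"
      unfolding at_to_0[of w] filterlim_filtermap using theta_over_z_tendsto by simp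
    have "((\<lambda>z. (wp_diff \<omega> 1 z w / (z - w)) * theta \<omega> z ^ 2 / (theta \<omega> (z + w) * (theta \<omega> (z - w) / (z - w))))
        \<longlongrightarrow> D * theta \<omega> w ^ 2 / (theta \<omega> (w + w) * theta_deriv)) (at w)"
      using theta_nonzero[OF w(2)] theta_deriv_nonzero
      by (intro tendsto_intros D th theta_tendsto) auto
    moreover have "eventually (\<lambda>z. (wp_diff \<omega> 1 z w / (z - w)) * theta \<omega> z ^ 2
        / (theta \<omega> (z + w) * (theta \<omega> (z - w) / (z - w))) = f z) (at w)"
      using eventually_neq_at_within[of w] by eventually_elim (simp add: f_def)
    ultimately show ?thesis by (auto simp: h_def dest: Lim_transform_eventually)
  qed
  have lim_neg_w: "h (- w) \<noteq> {}"
  proof -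
    \<comment> \<open>Evenness of \<open>f\<close> carries the limit at w over to -w.\<close>
    from lim_w obtain l where "(f \<longlongrightarrow> l) (at w)" by (auto simp: h_def)
    hence "((\<lambda>z. f (- z)) \<longlongrightarrow> l) (at w)"
      using tendsto_cong[OF eventually_mono[OF ev[of w] f_even]] by simp
    hence "(f \<longlongrightarrow> l) (at (- w))"
      by (simp add: filtermap_at_minus[symmetric] filterlim_filtermap)
    thus ?thesis by (auto simp: h_def)
  qed
  have lim: "h z0 \<noteq> {}" for z0
  proof -
    consider "z0 \<in> S" | "\<not> off z0" | "\<not> off (z0 + w)" | "\<not> off (z0 - w)"
      by (auto simp: S_def)
    thus ?thesis
    proof cases
      case 1
      hence "isCont f z0"
        using f_hol \<open>open S\<close> holomorphic_on_imp_continuous_on continuous_on_eq_continuous_at by blast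
      thus ?thesis by (auto simp: h_def isCont_def)
    next
      case 2
      then obtain p where "z0 = lat \<omega> 1 p" by (rule not_offE)
      thus ?thesis using h_lat[of 0 p] lim_0 by auto
    next
      case 3
      then obtain p where "z0 + w = lat \<omega> 1 p" by (rule not_offE)
      hence "z0 = - w + lat \<omega> 1 p" by (simp add: algebra_simps)
      thus ?thesis using h_lat[of "-w" p] lim_neg_w by auto
    next
      case 4
      then obtain p where "z0 - w = lat \<omega> 1 p" by (rule not_offE)
      hence "z0 = w + lat \<omega> 1 p" by (simp add: algebra_simps)
      thus ?thesis using h_lat[of w p] lim_w by auto
    qed
  qed
  \<comment> \<open>Since \<open>f\<close> has a limit everywhere, filling in these limits yields an
    entire function; uniqueness of limits makes it inherit the periods from
    \<open>h\<close>.\<close>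
  define g where "g = remove_sings f"
  have g_in: "g z0 \<in> h z0" for z0
    using lim[of z0] by (auto simp: h_def g_def remove_sings_eqI)
  have g_eq: "g z0 = l" if "l \<in> h z0" for z0 l
    using that by (auto simp: h_def g_def remove_sings_eqI)
  have g_ana: "g analytic_on {z0}" for z0
    unfolding g_def
  proof (rule remove_sings_analytic_at)
    show "isolated_singularity_at f z0"
      unfolding isolated_singularity_at_altdef using ev[of z0]
      by eventually_elim (use f_hol \<open>open S\<close> analytic_at in blast)
    show "(f \<longlongrightarrow> g z0) (at z0)" using g_in[of z0] by (simp add: h_def)
  qed
  have g_hol: "g holomorphic_on UNIV"
    using g_ana by (intro analytic_imp_holomorphic) (subst analytic_on_analytic_at, auto)
  have "bounded (range g)"
    by (rule doubly_periodic_bounded)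
       (use g_hol holomorphic_on_imp_continuous_on g_eq g_in h_1 h_\<omega> in \<open>blast+\<close>)
  with g_hol have "g constant_on UNIV" by (rule Liouville_theorem)
  hence "g z = g 0" unfolding constant_on_def by (metis UNIV_I)
  also have "g 0 = C" by (rule g_eq[OF lim_0])
  also have "g z = f z"
  proof -
    have "z \<in> S" using z by (simp add: S_def)
    hence "f analytic_on {z}" using f_hol \<open>open S\<close> analytic_at by blast
    thus ?thesis by (simp add: g_def)
  qed
  finally have "f z = C" .
  thus ?thesis
    using theta_nonzero[OF z(1)] theta_nonzero[OF z(2)] theta_nonzero[OF z(3)] theta_nonzero[OF w(1)]
    by (simp add: f_def C_def field_simps)
qed

end

section \<open>Ten-torsion points\<close>

text \<open>With periods \<open>10 * \<tau>\<close> and 1 the two arguments are torsion points of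
  order dividing 10, and the base of the theta products is q^10, as in \<open>I_fun\<close> and
  \<open>J_fun\<close>.\<close>

definition torsion_diff :: "int \<Rightarrow> int \<Rightarrow> complex \<Rightarrow> complex" where
  "torsion_diff i j \<tau> = wp_diff (10 * \<tau>) 1 (of_int i * \<tau>) (of_int j * \<tau>)"

lemma torsion_diff_minus: "torsion_diff j i \<tau> = - torsion_diff i j \<tau>"
  unfolding torsion_diff_def by (rule wp_diff_minus)

locale upper_half =
  fixes \<tau> :: complex
  assumes Im_\<tau>: "Im \<tau> > 0"

sublocale upper_half \<subseteq> theta_lattice "10 * \<tau>"
  by unfold_locales (use Im_\<tau> in auto)

context upper_half
begin

lemma off_torsion:
  assumes "\<not> 10 dvd k"
  shows "off (of_int k * \<tau>)"
  unfolding off_def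
proof safe
  fix m n :: int
  assume "of_int k * \<tau> + lat (10 * \<tau>) 1 (m, n) = 0"
  hence "of_int (k + 10 * m) * \<tau> + of_int n = 0" by (simp add: lat_def algebra_simps)
  hence "Im (of_int (k + 10 * m) * \<tau> + of_int n) = 0" by simp
  hence "k + 10 * m = 0" using Im_\<tau> by (simp flip: of_int_add)
  with assms show False by presburger
qed

lemma torsion_diff_add:
  assumes "\<not> 10 dvd i" "\<not> 10 dvd j" "\<not> 10 dvd k"
  shows "torsion_diff i j \<tau> + torsion_diff j k \<tau> = torsion_diff i k \<tau>"
  unfolding torsion_diff_def by (intro wp_diff_add off_torsion assms)

text \<open>Periodicity under \<open>10 * \<tau>\<close> and evenness reduce the index modulo 10 and
  up to sign.\<close>

lemma torsion_diff_cong_left: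
  assumes "\<not> 10 dvd i" "\<not> 10 dvd j" "10 dvd (i - i') \<or> 10 dvd (i + i')"
  shows "torsion_diff i j \<tau> = torsion_diff i' j \<tau>"
  using assms(3)
proof
  assume "10 dvd (i - i')"
  then obtain m where m: "i - i' = 10 * m" by (elim dvdE)
  have i': "i' = i + 10 * (- m)" using m by simp
  have "of_int i' * \<tau> = of_int i * \<tau> + of_int (- m) * (10 * \<tau>) + of_int 0 * 1"
    unfolding i' by (simp add: algebra_simps)
  thus ?thesis
    unfolding torsion_diff_def
    using wp_diff_translate[OF off_torsion[OF assms(1)] off_torsion[OF assms(2)], of "-m" 0] by (simp only:)
next
  assume "10 dvd (i + i')"
  then obtain m where m: "i + i' = 10 * m" by (elim dvdE)
  have i': "i' = - i + 10 * m" using m by simp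
  have "of_int i' * \<tau> = - (of_int i * \<tau>) + of_int m * (10 * \<tau>) + of_int 0 * 1"
    unfolding i' by (simp add: algebra_simps)
  thus ?thesis
    unfolding torsion_diff_def
    using wp_diff_translate[OF off_uminus[OF off_torsion[OF assms(1)]] off_torsion[OF assms(2)], of m 0]
      wp_diff_even[OF off_torsion[OF assms(1)] off_torsion[OF assms(2)]]
    by (simp only:)
qed

lemma torsion_diff_cong:
  assumes "\<not> 10 dvd i" "\<not> 10 dvd j" "10 dvd (i - i') \<or> 10 dvd (i + i')" "10 dvd (j - j') \<or> 10 dvd (j + j')"
  shows "torsion_diff i j \<tau> = torsion_diff i' j' \<tau>"
proof -
  have "\<not> 10 dvd i'" using assms by presburger
  hence "torsion_diff i' j \<tau> = torsion_diff i' j' \<tau>"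
    using torsion_diff_cong_left[of j i' j'] assms torsion_diff_minus by metis
  thus ?thesis using torsion_diff_cong_left[of i j i'] assms by simp
qed

text \<open>The condition \<open>\<not> 5 dvd j\<close> keeps twice the second point off the
  lattice, as the product formula demands.\<close>

lemma torsion_diff_eq_theta:
  assumes "\<not> 10 dvd i" "\<not> 5 dvd j" "\<not> 10 dvd (i + j)" "\<not> 10 dvd (i - j)"
  shows "torsion_diff i j \<tau> = - (theta_deriv ^ 2) * qq (of_int j * \<tau>)
     * theta (10 * \<tau>) (of_int (i + j) * \<tau>) * theta (10 * \<tau>) (of_int (i - j) * \<tau>)
     / (theta (10 * \<tau>) (of_int i * \<tau>) ^ 2 * theta (10 * \<tau>) (of_int j * \<tau>) ^ 2)"
proof -
  have "\<not> 10 dvd j" "\<not> 10 dvd (j + j)" using assms by presburger+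
  hence "off (of_int j * \<tau>)" "off (of_int j * \<tau> + of_int j * \<tau>)"
    using off_torsion[of j] off_torsion[of "j + j"] by (simp_all add: algebra_simps)
  moreover have "off (of_int i * \<tau>)" "off (of_int i * \<tau> + of_int j * \<tau>)" "off (of_int i * \<tau> - of_int j * \<tau>)"
    using assms off_torsion[of i] off_torsion[of "i + j"] off_torsion[of "i - j"]
    by (simp_all add: algebra_simps)
  ultimately show ?thesis
    unfolding torsion_diff_def using wp_diff_eq_theta[of "of_int j * \<tau>" "of_int i * \<tau>"]
    by (simp add: algebra_simps)
qed

section \<open>Theta values at torsion points and their relations\<close>

definition a :: "nat \<Rightarrow> complex" where
  "a k = theta (10 * \<tau>) (of_nat k * \<tau>)"

lemma a_nonzero:
  assumes "0 < k" "k < 10"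
  shows "a k \<noteq> 0"
proof -
  have "\<not> 10 dvd int k" using assms by presburger
  thus ?thesis using theta_nonzero[OF off_torsion[of "int k"]] by (simp add: a_def)
qed

lemma a_reflect: "a 9 = a 1" "a 7 = a 3" "a 6 = a 4"
  using theta_reflect[of \<tau>] theta_reflect[of "3 * \<tau>"] theta_reflect[of "4 * \<tau>"]
  by (simp_all add: a_def algebra_simps)

lemma qpochinf_eq_a:
  assumes "k \<le> 10"
  shows "qpochinf (qq \<tau> ^ k) (qq \<tau> ^ 10) * qpochinf (qq \<tau> ^ (10 - k)) (qq \<tau> ^ 10) = a k"
  using assms qq_of_nat_mult[of 10 \<tau>]
  by (simp add: a_def theta_def qq_of_nat_mult power_diff)

lemma torsion_diff_eq:
  assumes "i \<in> {1..5}" "j \<in> {1..4}" "j < i"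
  shows "torsion_diff (int i) (int j) \<tau> = - (theta_deriv ^ 2) * qq \<tau> ^ j * a (i + j) * a (i - j) / (a i ^ 2 * a j ^ 2)"
proof -
  have "\<not> 10 dvd int i" "\<not> 5 dvd int j" "\<not> 10 dvd (int i + int j)" "\<not> 10 dvd (int i - int j)"
    using assms by (auto; presburger)+
  from torsion_diff_eq_theta[OF this] assms show ?thesis
    by (simp add: a_def qq_of_nat_mult of_nat_diff)
qed

text \<open>These are all the differences entering the two theta relations and the formula for the
  square of U. Reflection folds the indices 6, 7 and 9 back to 4, 3 and 1.\<close>

lemma torsion_diff_values:
  defines "c \<equiv> - (theta_deriv ^ 2)" and "q \<equiv> qq \<tau>"
  shows "torsion_diff 4 2 \<tau> = c * q ^ 2 * a 4 * a 2 / (a 4 ^ 2 * a 2 ^ 2)"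
    and "torsion_diff 3 1 \<tau> = c * q * a 4 * a 2 / (a 3 ^ 2 * a 1 ^ 2)"
    and "torsion_diff 3 2 \<tau> = c * q ^ 2 * a 5 * a 1 / (a 3 ^ 2 * a 2 ^ 2)"
    and "torsion_diff 4 1 \<tau> = c * q * a 5 * a 3 / (a 4 ^ 2 * a 1 ^ 2)"
    and "torsion_diff 4 3 \<tau> = c * q ^ 3 * a 3 * a 1 / (a 4 ^ 2 * a 3 ^ 2)"
    and "torsion_diff 2 1 \<tau> = c * q * a 3 * a 1 / (a 2 ^ 2 * a 1 ^ 2)"
    and "torsion_diff 5 2 \<tau> = c * q ^ 2 * a 3 * a 3 / (a 5 ^ 2 * a 2 ^ 2)"
    and "torsion_diff 5 4 \<tau> = c * q ^ 4 * a 1 * a 1 / (a 5 ^ 2 * a 4 ^ 2)"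
  unfolding c_def q_def
  using torsion_diff_eq[of 4 2] torsion_diff_eq[of 3 1] torsion_diff_eq[of 3 2] torsion_diff_eq[of 4 1]
    torsion_diff_eq[of 4 3] torsion_diff_eq[of 2 1] torsion_diff_eq[of 5 2] torsion_diff_eq[of 5 4]
  by (simp_all add: a_reflect)

lemma theta_relation_1: "a 2 ^ 2 * a 4 ^ 2 - qq \<tau> * a 1 ^ 2 * a 3 ^ 2 = a 5 ^ 2 * a 1 * a 3"
proof -
  let ?D = "\<lambda>i j. torsion_diff i j \<tau>"
  let ?P = "a 1 ^ 2 * a 2 ^ 2 * a 3 ^ 2 * a 4 ^ 2" and ?c = "theta_deriv ^ 4 * qq \<tau> ^ 3"
  \<comment> \<open>Expressing everything through \<open>?D 3 1\<close>, \<open>?D 4 2\<close> and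
    \<open>?D 2 1\<close> turns the three-term identity into a polynomial one; multiplication by
    \<open>?P\<close> then clears all denominators.\<close>
  have 1: "?D 3 2 = ?D 3 1 - ?D 2 1" "?D 4 1 = ?D 4 2 + ?D 2 1" "?D 4 3 = ?D 4 2 + ?D 2 1 - ?D 3 1"
    using torsion_diff_add[of 3 2 1] torsion_diff_add[of 4 2 1] torsion_diff_add[of 4 3 1] by (auto simp: algebra_simps)
  have "?D 3 1 * ?D 4 2 - ?D 3 2 * ?D 4 1 = ?D 4 3 * ?D 2 1"
    unfolding 1 by (simp add: algebra_simps)
  hence "?D 3 1 * ?D 4 2 * ?P - ?D 3 2 * ?D 4 1 * ?P = ?D 4 3 * ?D 2 1 * ?P"
    by (simp only: flip: left_diff_distrib)
  moreover have "a 1 \<noteq> 0" "a 2 \<noteq> 0" "a 3 \<noteq> 0" "a 4 \<noteq> 0" "a 5 \<noteq> 0" by (simp_all add: a_nonzero)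
  hence "?D 3 1 * ?D 4 2 * ?P = ?c * (a 2 ^ 2 * a 4 ^ 2)"
    "?D 3 2 * ?D 4 1 * ?P = ?c * (a 5 ^ 2 * a 1 * a 3)"
    "?D 4 3 * ?D 2 1 * ?P = ?c * (qq \<tau> * a 1 ^ 2 * a 3 ^ 2)"
    unfolding torsion_diff_values by (simp_all add: field_simps power2_eq_square eval_nat_numeral)
  ultimately have "?c * (a 2 ^ 2 * a 4 ^ 2) - ?c * (a 5 ^ 2 * a 1 * a 3) = ?c * (qq \<tau> * a 1 ^ 2 * a 3 ^ 2)"
    by (simp only:)
  hence "?c * (a 2 ^ 2 * a 4 ^ 2 - qq \<tau> * a 1 ^ 2 * a 3 ^ 2) = ?c * (a 5 ^ 2 * a 1 * a 3)"
    by algebra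
  thus ?thesis using theta_deriv_nonzero by simp
qed

text \<open>Denominators are cleared in the additive relation among the points of index 5, 4 and 2.
  The index 5 occurs only in first position, where the product formula admits a point of order
  2.\<close>

lemma theta_relation_2: "a 3 ^ 2 * a 4 ^ 2 - qq \<tau> ^ 2 * a 1 ^ 2 * a 2 ^ 2 = a 5 ^ 2 * a 2 * a 4"
proof -
  let ?D = "\<lambda>i j. torsion_diff i j \<tau>"
  let ?P = "a 5 ^ 2 * a 2 ^ 2 * a 4 ^ 2" and ?c = "- (theta_deriv ^ 2) * qq \<tau> ^ 2"
  have "?D 5 4 + ?D 4 2 = ?D 5 2" by (rule torsion_diff_add) auto
  hence "?D 5 4 * ?P + ?D 4 2 * ?P = ?D 5 2 * ?P"
    by (simp only: flip: distrib_right)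
  moreover have "a 1 \<noteq> 0" "a 2 \<noteq> 0" "a 3 \<noteq> 0" "a 4 \<noteq> 0" "a 5 \<noteq> 0" by (simp_all add: a_nonzero)
  hence "?D 5 4 * ?P = ?c * (qq \<tau> ^ 2 * a 1 ^ 2 * a 2 ^ 2)"
    "?D 4 2 * ?P = ?c * (a 5 ^ 2 * a 2 * a 4)"
    "?D 5 2 * ?P = ?c * (a 3 ^ 2 * a 4 ^ 2)"
    unfolding torsion_diff_values by (simp_all add: field_simps power2_eq_square eval_nat_numeral)
  ultimately have "?c * (qq \<tau> ^ 2 * a 1 ^ 2 * a 2 ^ 2) + ?c * (a 5 ^ 2 * a 2 * a 4) = ?c * (a 3 ^ 2 * a 4 ^ 2)"
    by (simp only:)
  hence "?c * (a 3 ^ 2 * a 4 ^ 2 - qq \<tau> ^ 2 * a 1 ^ 2 * a 2 ^ 2) = ?c * (a 5 ^ 2 * a 2 * a 4)"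
    by algebra
  thus ?thesis using theta_deriv_nonzero by simp
qed

end

section \<open>The functions I and J\<close>

text \<open>For k = I J and v = (I/J)^2 both left-hand sides are k^2 + 1/k^2, multiplied or divided
  by v, and k^2 + 1/k^2 = (1/k - k)^2 + 2 is a function of v by hypothesis.\<close>

lemma k_parametrization:
  fixes k v :: complex
  assumes nz: "k \<noteq> 0" "v \<noteq> 0" and rel: "1 / k - k = 1 / v - 1"
  shows "k ^ 2 * v + 1 / (k ^ 2 / v) = 1 / v - 2 + 3 * v"
    and "k ^ 2 / v + 1 / (k ^ 2 * v) = 1 / v ^ 3 - 2 / v ^ 2 + 3 / v"
proof -
  have "k ^ 2 + 1 / k ^ 2 = (1 / k - k) ^ 2 + 2"
    using nz by (simp add: field_simps power2_eq_square)
  also have "\<dots> = (1 / v - 1) ^ 2 + 2" by (simp only: rel)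
  finally have *: "k ^ 2 + 1 / k ^ 2 = (1 / v - 1) ^ 2 + 2" .
  have "k ^ 2 * v + 1 / (k ^ 2 / v) = v * (k ^ 2 + 1 / k ^ 2)"
    using nz by (simp add: field_simps)
  also have "\<dots> = 1 / v - 2 + 3 * v"
    unfolding * using nz by (simp add: field_simps power2_eq_square)
  finally show "k ^ 2 * v + 1 / (k ^ 2 / v) = 1 / v - 2 + 3 * v" .
  have "k ^ 2 / v + 1 / (k ^ 2 * v) = (k ^ 2 + 1 / k ^ 2) / v"
    using nz by (simp add: field_simps)
  also have "\<dots> = 1 / v ^ 3 - 2 / v ^ 2 + 3 / v"
    unfolding * using nz by (simp add: field_simps power2_eq_square power3_eq_cube)
  finally show "k ^ 2 / v + 1 / (k ^ 2 * v) = 1 / v ^ 3 - 2 / v ^ 2 + 3 / v" .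
qed

context upper_half
begin

lemma a_nz: "a 1 \<noteq> 0" "a (Suc 0) \<noteq> 0" "a 2 \<noteq> 0" "a 3 \<noteq> 0" "a 4 \<noteq> 0" "a 5 \<noteq> 0"
  by (simp_all add: a_nonzero)

text \<open>Both prefactors become powers of q^(1/4). Only its fourth power survives in I^4, J^4 and
  (I/J)^2.\<close>

lemma I_fun_eq: "I_fun \<tau> = qpow (1/4) \<tau> ^ 3 * a 1 / a 4"
  and J_fun_eq: "J_fun \<tau> = qpow (1/4) \<tau> * a 2 / a 3"
proof -
  have "qpow (3/4) \<tau> = qpow (1/4) \<tau> ^ 3"
    unfolding qpow_def by (simp add: exp_of_nat_mult[symmetric] of_rat_divide mult_ac)
  thus "I_fun \<tau> = qpow (1/4) \<tau> ^ 3 * a 1 / a 4" "J_fun \<tau> = qpow (1/4) \<tau> * a 2 / a 3"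
    using qpochinf_eq_a[of 1] qpochinf_eq_a[of 2] qpochinf_eq_a[of 3] qpochinf_eq_a[of 4]
    by (simp_all add: I_fun_def J_fun_def)
qed

lemma qpow_quarter: "qpow (1/4) \<tau> ^ 4 = qq \<tau>"
  unfolding qpow_def qq_def by (simp add: exp_of_nat_mult[symmetric] of_rat_divide mult_ac)

lemma U_squared: "(I_fun \<tau> / J_fun \<tau>) ^ 2 = qq \<tau> * a 1 ^ 2 * a 3 ^ 2 / (a 2 ^ 2 * a 4 ^ 2)"
proof -
  have "qpow (1/4) \<tau> \<noteq> 0" by (simp add: qpow_def)
  thus ?thesis
    unfolding I_fun_eq J_fun_eq qpow_quarter[symmetric] using a_nz
    by (simp add: field_simps power2_eq_square eval_nat_numeral)
qed

lemma U_squared_nonzero: "(I_fun \<tau> / J_fun \<tau>) ^ 2 \<noteq> 0"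
  unfolding U_squared using a_nz by simp

lemma torsion_diff_3_1_nonzero: "torsion_diff 3 1 \<tau> \<noteq> 0"
  unfolding torsion_diff_values using a_nz theta_deriv_nonzero by simp

text \<open>The passage from infinite products to lattice sums, whose transformation under integer
  matrices is visible.\<close>

lemma U_squared_eq_torsion: "(I_fun \<tau> / J_fun \<tau>) ^ 2 = torsion_diff 4 2 \<tau> / torsion_diff 3 1 \<tau>"
  unfolding U_squared torsion_diff_values using a_nz theta_deriv_nonzero
  by (simp add: field_simps power2_eq_square)

lemma IJ_identities:
  defines "v \<equiv> (I_fun \<tau> / J_fun \<tau>) ^ 2"
  shows "I_fun \<tau> ^ 4 + 1 / J_fun \<tau> ^ 4 = 1 / v - 2 + 3 * v"
    and "J_fun \<tau> ^ 4 + 1 / I_fun \<tau> ^ 4 = 1 / v ^ 3 - 2 / v ^ 2 + 3 / v"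
proof -
  \<comment> \<open>This is the product of \<open>I_fun \<tau>\<close> and
    \<open>J_fun \<tau>\<close>.\<close>
  define k where "k = qq \<tau> * a 1 * a 2 / (a 3 * a 4)"
  have v: "v = qq \<tau> * a 1 ^ 2 * a 3 ^ 2 / (a 2 ^ 2 * a 4 ^ 2)" by (simp add: v_def U_squared)
  have nz: "k \<noteq> 0" "v \<noteq> 0" using a_nz by (simp_all add: k_def v)
  \<comment> \<open>The second theta relation rewrites the numerator and produces
    \<open>a 5 ^ 2\<close>; the first then eliminates \<open>a 5\<close>.\<close>
  have "1 / k - k = (a 3 ^ 2 * a 4 ^ 2 - qq \<tau> ^ 2 * a 1 ^ 2 * a 2 ^ 2) / (qq \<tau> * a 1 * a 2 * a 3 * a 4)"
    unfolding k_def using a_nz by (simp add: field_simps power2_eq_square)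
  also have "\<dots> = a 5 ^ 2 / (qq \<tau> * a 1 * a 3)"
    unfolding theta_relation_2 using a_nz by (simp add: field_simps power2_eq_square)
  also have "\<dots> = (a 5 ^ 2 * a 1 * a 3) / (qq \<tau> * a 1 ^ 2 * a 3 ^ 2)"
    using a_nz by (simp add: field_simps power2_eq_square)
  also have "\<dots> = 1 / v - 1"
    unfolding theta_relation_1[symmetric] v using a_nz by (simp add: field_simps power2_eq_square)
  finally have rel: "1 / k - k = 1 / v - 1" .
  have "I_fun \<tau> ^ 4 = qq \<tau> ^ 3 * a 1 ^ 4 / a 4 ^ 4"
    unfolding I_fun_eq qpow_quarter[symmetric]
    by (simp add: power_divide power_mult_distrib flip: power_mult)
  also have "\<dots> = k ^ 2 * v"
    unfolding k_def v using a_nz by (simp add: field_simps power2_eq_square eval_nat_numeral)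
  finally have I: "I_fun \<tau> ^ 4 = k ^ 2 * v" .
  have "J_fun \<tau> ^ 4 = qq \<tau> * a 2 ^ 4 / a 3 ^ 4"
    unfolding J_fun_eq qpow_quarter[symmetric]
    by (simp add: power_divide power_mult_distrib)
  also have "\<dots> = k ^ 2 / v"
    unfolding k_def v using a_nz by (simp add: field_simps power2_eq_square eval_nat_numeral)
  finally have J: "J_fun \<tau> ^ 4 = k ^ 2 / v" .
  show "I_fun \<tau> ^ 4 + 1 / J_fun \<tau> ^ 4 = 1 / v - 2 + 3 * v"
    "J_fun \<tau> ^ 4 + 1 / I_fun \<tau> ^ 4 = 1 / v ^ 3 - 2 / v ^ 2 + 3 / v"
    unfolding I J by (rule k_parametrization[OF nz rel])+
qed

end

section \<open>Modular transformations\<close>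

text \<open>The weight 2 slash action of a matrix on \<^const>\<open>torsion_diff\<close>, written as a lattice sum so that no
  factor \<open>c\<tau> + d\<close> appears in the denominators.\<close>

definition slash_diff :: "int \<Rightarrow> int \<Rightarrow> int \<Rightarrow> int \<Rightarrow> int \<Rightarrow> int \<Rightarrow> complex \<Rightarrow> complex" where
  "slash_diff a b c d i j \<tau> = (let \<alpha> = of_int a * \<tau> + of_int b; \<beta> = of_int c * \<tau> + of_int d
     in wp_diff (10 * \<alpha>) \<beta> (of_int i * \<alpha>) (of_int j * \<alpha>))"

lemma torsion_diff_eq_slash: "torsion_diff i j = slash_diff 1 0 0 1 i j"
  by (simp add: fun_eq_iff torsion_diff_def slash_diff_def)

text \<open>Rescaling by the denominator of the Moebius map turns the second period 1 into that
  denominator and the torsion points into multiples of the numerator.\<close>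

lemma torsion_diff_moebius:
  assumes "of_int c * \<tau> + of_int d \<noteq> 0"
  shows "torsion_diff i j (moebius_int a b c d \<tau>)
       = (of_int c * \<tau> + of_int d) ^ 2 * slash_diff a b c d i j \<tau>"
proof -
  define \<alpha> \<beta> where "\<alpha> = of_int a * \<tau> + of_int b" and "\<beta> = of_int c * \<tau> + of_int d"
  have "\<beta> \<noteq> 0" using assms by (simp add: \<beta>_def)
  from wp_diff_scale[OF this, of "10 * (\<alpha> / \<beta>)" 1 "of_int i * (\<alpha> / \<beta>)" "of_int j * (\<alpha> / \<beta>)"] this
  have "wp_diff (10 * (\<alpha> / \<beta>)) 1 (of_int i * (\<alpha> / \<beta>)) (of_int j * (\<alpha> / \<beta>))
      = \<beta> ^ 2 * wp_diff (10 * \<alpha>) \<beta> (of_int i * \<alpha>) (of_int j * \<alpha>)"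
    by (simp add: field_simps)
  thus ?thesis
    unfolding torsion_diff_def slash_diff_def moebius_int_def Let_def \<alpha>_def \<beta>_def .
qed

section \<open>Uniform estimates and periodicity for a fixed integer matrix of determinant 1\<close>

context
  fixes a b c d :: int
  assumes det: "a * d - b * c = 1"
begin

lemma moebius_denominator_nonzero:
  assumes "Im \<tau> > 0"
  shows "of_int c * \<tau> + of_int d \<noteq> 0"
proof
  assume *: "of_int c * \<tau> + of_int d = 0"
  hence "Im (of_int c * \<tau> + of_int d) = 0" by simp
  hence "c = 0" using assms by simp
  with * det show False by simp
qed

text \<open>The determinant of the transformed lattice does not depend on the matrix; it gives
  nondegeneracy and the constant in the lower bounds below.\<close>

lemma slash_lattice_det: "Im ((10 * (of_int a * \<tau> + of_int b)) * cnj (of_int c * \<tau> + of_int d)) = 10 * Im \<tau>"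
proof -
  have "Im ((10 * (of_int a * \<tau> + of_int b)) * cnj (of_int c * \<tau> + of_int d))
      = 10 * Im \<tau> * of_int (a * d - b * c)"
    by (simp add: algebra_simps)
  thus ?thesis by (simp add: det)
qed

lemma Im_moebius:
  assumes "Im \<tau> > 0"
  shows "Im (moebius_int a b c d \<tau>) > 0"
proof -
  define \<alpha> \<beta> where "\<alpha> = of_int a * \<tau> + of_int b" and "\<beta> = of_int c * \<tau> + of_int d"
  have "moebius_int a b c d \<tau> = (\<alpha> * cnj \<beta>) / of_real (norm \<beta> ^ 2)"
    unfolding moebius_int_def \<alpha>_def[symmetric] \<beta>_def[symmetric] by (subst complex_div_cnj) simp
  hence "Im (moebius_int a b c d \<tau>) = Im (\<alpha> * cnj \<beta>) / norm \<beta> ^ 2"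
    by (simp only: Im_divide_of_real)
  also have "Im (\<alpha> * cnj \<beta>) = Im ((10 * \<alpha>) * cnj \<beta>) / 10"
    by simp
  also have "\<dots> = Im \<tau>"
    unfolding \<alpha>_def \<beta>_def slash_lattice_det by simp
  also have "Im \<tau> / norm \<beta> ^ 2 > 0"
    using assms moebius_denominator_nonzero[OF assms] by (simp add: \<beta>_def)
  finally show ?thesis .
qed

text \<open>In the basis of the lattice the shifted points have real coordinates m + i/10 and n, and
  the first one stays away from 0. The lattice determinant and the size of the basis vectors are
  both of order \<open>Im \<tau>\<close> in the strip, so \<open>\<tau>\<close> cancels and one
  constant serves all \<open>\<tau>\<close> and \<open>i\<close>.\<close>

lemma separated_slash:
  fixes R \<epsilon> :: real
  assumes "\<epsilon> > 0"
  obtains \<delta> where "\<And>\<tau> i. Im \<tau> \<ge> \<epsilon> \<Longrightarrow> \<bar>Re \<tau>\<bar> \<le> R \<Longrightarrow> i \<in> {1..9} \<Longrightarrow>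
    separated UNIV \<delta> (10 * (of_int a * \<tau> + of_int b)) (of_int c * \<tau> + of_int d) (of_int i * (of_int a * \<tau> + of_int b))"
proof -
  define K where "K = 10 * \<bar>real_of_int a\<bar> + \<bar>real_of_int c\<bar>"
  define K' where "K' = 10 * \<bar>real_of_int b\<bar> + \<bar>real_of_int d\<bar>"
  \<comment> \<open>Chosen so that the two basis vectors together have norm at most
    \<open>M * Im \<tau>\<close>; constant terms are absorbed by
    \<open>Im \<tau> / \<epsilon> \<ge> 1\<close>, and the final 1 makes \<open>M\<close>
    positive.\<close>
  define M where "M = K + (K * \<bar>R\<bar> + K') / \<epsilon> + 1"
  have K: "K \<ge> 0" "K' \<ge> 0" by (simp_all add: K_def K'_def)
  have "M > 0" using K assms unfolding M_def by (intro add_nonneg_pos add_nonneg_nonneg divide_nonneg_pos) auto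
  show ?thesis
  proof (rule that[of "1 / (2 * M)"])
    fix \<tau> :: complex and i :: int
    assume \<tau>: "Im \<tau> \<ge> \<epsilon>" "\<bar>Re \<tau>\<bar> \<le> R" and i: "i \<in> {1..9}"
    define \<alpha> \<beta> where "\<alpha> = of_int a * \<tau> + of_int b" and "\<beta> = of_int c * \<tau> + of_int d"
    have pos: "Im \<tau> > 0" using \<tau> assms by simp
    have "norm \<tau> \<le> Im \<tau> + \<bar>R\<bar>" using cmod_le[of \<tau>] \<tau> pos by simp
    have "norm (10 * \<alpha>) + norm \<beta> = 10 * norm \<alpha> + norm \<beta>" by (simp add: norm_mult)
    also have "\<dots> \<le> K * norm \<tau> + K'"
      using norm_triangle_ineq[of "of_int a * \<tau>" "of_int b"] norm_triangle_ineq[of "of_int c * \<tau>" "of_int d"]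
      by (simp add: \<alpha>_def \<beta>_def K_def K'_def norm_mult algebra_simps)
    also have "\<dots> \<le> K * (Im \<tau> + \<bar>R\<bar>) + K'"
      using \<open>norm \<tau> \<le> _\<close> K by (intro add_right_mono mult_left_mono) auto
    also have "\<dots> = K * Im \<tau> + (K * \<bar>R\<bar> + K') * 1" by (simp add: algebra_simps)
    also have "\<dots> \<le> K * Im \<tau> + (K * \<bar>R\<bar> + K') * (Im \<tau> / \<epsilon>)"
      using K \<tau> assms by (intro add_left_mono mult_left_mono) (auto simp: field_simps)
    also have "\<dots> \<le> M * Im \<tau>"
      using pos by (simp add: M_def algebra_simps add_divide_distrib)
    finally have M: "norm (10 * \<alpha>) + norm \<beta> \<le> M * Im \<tau>" .
    show "separated UNIV (1 / (2 * M)) (10 * \<alpha>) \<beta> (of_int i * \<alpha>)"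
      unfolding separated_def
    proof (intro conjI ballI)
      fix p :: "int \<times> int"
      obtain m n where p: "p = (m, n)" by (cases p)
      define x where "x = real_of_int m + real_of_int i / 10"
      \<comment> \<open>The factor 1/20 is dictated by the worst case m = -1, i = 9, where both
        sides equal 1/10.\<close>
      have "(1 + \<bar>real_of_int m\<bar>) / 20 \<le> \<bar>x\<bar>"
      proof (cases "m \<ge> 0")
        case True
        hence "real_of_int m \<ge> 0" "real_of_int i \<ge> 1" using i by auto
        thus ?thesis by (simp add: x_def)
      next
        case False
        hence "real_of_int m \<le> -1" "real_of_int i \<le> 9" using i by auto
        thus ?thesis by (simp add: x_def)
      qed
      hence "weight p / 20 \<le> \<bar>x\<bar> + \<bar>real_of_int n\<bar>"
        by (simp add: weight_def p)
      hence "10 * Im \<tau> * (weight p / 20) \<le> 10 * Im \<tau> * (\<bar>x\<bar> + \<bar>real_of_int n\<bar>)"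
        using pos by (intro mult_left_mono) auto
      also have "\<dots> \<le> norm (of_real x * (10 * \<alpha>) + of_real (of_int n) * \<beta>) * (norm (10 * \<alpha>) + norm \<beta>)"
        using lattice_lower_bound[of "10 * \<alpha>" \<beta> x "of_int n"] pos
        unfolding \<alpha>_def \<beta>_def slash_lattice_det by simp
      also have "of_real x * (10 * \<alpha>) + of_real (of_int n) * \<beta> = of_int i * \<alpha> + lat (10 * \<alpha>) \<beta> p"
        by (simp add: x_def p lat_def algebra_simps)
      also have "norm (of_int i * \<alpha> + lat (10 * \<alpha>) \<beta> p) * (norm (10 * \<alpha>) + norm \<beta>)
          \<le> norm (of_int i * \<alpha> + lat (10 * \<alpha>) \<beta> p) * (M * Im \<tau>)"
        using M by (intro mult_left_mono) auto
      finally have "weight p / 2 * Im \<tau> \<le> (norm (of_int i * \<alpha> + lat (10 * \<alpha>) \<beta> p) * M) * Im \<tau>"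
        by (simp add: mult_ac)
      hence "weight p / 2 \<le> norm (of_int i * \<alpha> + lat (10 * \<alpha>) \<beta> p) * M"
        using pos by (simp only: mult_le_cancel_right_pos)
      thus "1 / (2 * M) * weight p \<le> norm (of_int i * \<alpha> + lat (10 * \<alpha>) \<beta> p)"
        using \<open>M > 0\<close> by (simp add: field_simps)
    qed (use \<open>M > 0\<close> in auto)
  qed
qed

lemma slash_diff_holomorphic:
  assumes "i \<in> {1..9}" "j \<in> {1..9}"
  shows "slash_diff a b c d i j holomorphic_on upper_half_plane"
proof -
  have "slash_diff a b c d i j analytic_on upper_half_plane"
    unfolding analytic_on_def
  proof
    fix \<tau>0 assume "\<tau>0 \<in> upper_half_plane"
    hence pos: "Im \<tau>0 > 0" by (simp add: upper_half_plane_def)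
    define r where "r = Im \<tau>0 / 2"
    have r: "r > 0" using pos by (simp add: r_def)
    obtain \<delta> where \<delta>: "\<And>\<tau> i. Im \<tau> \<ge> r \<Longrightarrow> \<bar>Re \<tau>\<bar> \<le> \<bar>Re \<tau>0\<bar> + r \<Longrightarrow> i \<in> {1..9} \<Longrightarrow>
       separated UNIV \<delta> (10 * (of_int a * \<tau> + of_int b)) (of_int c * \<tau> + of_int d) (of_int i * (of_int a * \<tau> + of_int b))"
      using separated_slash[OF r] by blast
    have "slash_diff a b c d i j holomorphic_on ball \<tau>0 r"
      unfolding slash_diff_def Let_def wp_diff_def
    proof (rule holomorphic_infsum_wp_term[where c = \<delta>
         and B = "\<bar>real_of_int (i - j)\<bar> * (\<bar>real_of_int a\<bar> * (norm \<tau>0 + r) + \<bar>real_of_int b\<bar>)"])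
      fix t assume t: "t \<in> ball \<tau>0 r"
      have n: "norm (t - \<tau>0) < r" using t by (simp add: dist_norm norm_minus_commute)
      have "\<bar>Im t - Im \<tau>0\<bar> < r" "\<bar>Re t - Re \<tau>0\<bar> < r"
        using n abs_Im_le_cmod[of "t - \<tau>0"] abs_Re_le_cmod[of "t - \<tau>0"] by auto
      hence "Im t \<ge> r" "\<bar>Re t\<bar> \<le> \<bar>Re \<tau>0\<bar> + r" unfolding r_def by linarith+
      thus "separated UNIV \<delta> (10 * (of_int a * t + of_int b)) (of_int c * t + of_int d) (of_int i * (of_int a * t + of_int b))"
        "separated UNIV \<delta> (10 * (of_int a * t + of_int b)) (of_int c * t + of_int d) (of_int j * (of_int a * t + of_int b))"
        using \<delta> assms by blast+
      have "norm t \<le> norm \<tau>0 + r" using n norm_triangle_ineq[of \<tau>0 "t - \<tau>0"] by simp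
      hence "norm (of_int a * t + of_int b) \<le> \<bar>real_of_int a\<bar> * (norm \<tau>0 + r) + \<bar>real_of_int b\<bar>"
        by (intro order_trans[OF norm_triangle_ineq] add_mono) (auto simp: norm_mult intro!: mult_left_mono)
      hence "\<bar>real_of_int (i - j)\<bar> * norm (of_int a * t + of_int b)
          \<le> \<bar>real_of_int (i - j)\<bar> * (\<bar>real_of_int a\<bar> * (norm \<tau>0 + r) + \<bar>real_of_int b\<bar>)"
        by (intro mult_left_mono) auto
      moreover have "of_int i * (of_int a * t + of_int b) - of_int j * (of_int a * t + of_int b)
          = of_int (i - j) * (of_int a * t + of_int b)" by (simp add: algebra_simps)
      ultimately show "norm (of_int i * (of_int a * t + of_int b) - of_int j * (of_int a * t + of_int b))
          \<le> \<bar>real_of_int (i - j)\<bar> * (\<bar>real_of_int a\<bar> * (norm \<tau>0 + r) + \<bar>real_of_int b\<bar>)"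
        by (simp only: norm_mult norm_of_int)
    qed (auto intro!: holomorphic_intros)
    thus "\<exists>e>0. slash_diff a b c d i j holomorphic_on ball \<tau>0 e" using r by blast
  qed
  thus ?thesis by (rule analytic_imp_holomorphic)
qed

text \<open>The separation constant is uniform in the strip, so the only growth comes from the
  distance of the two points, which is linear in \<open>\<tau>\<close>.\<close>

lemma slash_diff_bound:
  assumes "i \<in> {1..9}" "j \<in> {1..9}"
  shows "\<exists>K. \<forall>\<tau>. Im \<tau> \<ge> 1 \<longrightarrow> \<bar>Re \<tau>\<bar> \<le> R \<longrightarrow> norm (slash_diff a b c d i j \<tau>) \<le> K * (1 + norm \<tau>)"
proof -
  obtain \<delta> where \<delta>: "\<And>\<tau> i. Im \<tau> \<ge> 1 \<Longrightarrow> \<bar>Re \<tau>\<bar> \<le> R \<Longrightarrow> i \<in> {1..9} \<Longrightarrow>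
       separated UNIV \<delta> (10 * (of_int a * \<tau> + of_int b)) (of_int c * \<tau> + of_int d) (of_int i * (of_int a * \<tau> + of_int b))"
    using separated_slash[of 1] by (metis zero_less_one)
  define W where "W = infsum (\<lambda>p. 1 / weight p ^ 3) UNIV"
  define L where "L = \<bar>real_of_int (i - j)\<bar> * (\<bar>real_of_int a\<bar> + \<bar>real_of_int b\<bar>)"
  have "W \<ge> 0" unfolding W_def by (intro infsum_nonneg) (auto simp: less_imp_le)
  show ?thesis
  proof (intro exI[of _ "L * (2 / \<delta> ^ 3) * W"] allI impI)
    fix \<tau> :: complex assume \<tau>: "Im \<tau> \<ge> 1" "\<bar>Re \<tau>\<bar> \<le> R"
    define \<alpha> where "\<alpha> = of_int a * \<tau> + of_int b"
    have "\<delta> > 0" using \<delta>[OF \<tau> assms(1)] by (simp add: separated_def)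
    have "norm \<alpha> \<le> \<bar>real_of_int a\<bar> * norm \<tau> + \<bar>real_of_int b\<bar>"
      unfolding \<alpha>_def by (intro order_trans[OF norm_triangle_ineq]) (auto simp: norm_mult)
    also have "\<dots> \<le> (\<bar>real_of_int a\<bar> + \<bar>real_of_int b\<bar>) * (1 + norm \<tau>)"
      by (simp add: algebra_simps)
    finally have "\<bar>real_of_int (i - j)\<bar> * norm \<alpha> \<le> L * (1 + norm \<tau>)"
      unfolding L_def mult.assoc by (intro mult_left_mono) auto
    moreover have "of_int i * \<alpha> - of_int j * \<alpha> = of_int (i - j) * \<alpha>" by (simp add: algebra_simps)
    ultimately have "norm (of_int i * \<alpha> - of_int j * \<alpha>) \<le> L * (1 + norm \<tau>)"
      by (simp only: norm_mult norm_of_int)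
    hence "norm (of_int i * \<alpha> - of_int j * \<alpha>) * (2 / \<delta> ^ 3) * W \<le> L * (1 + norm \<tau>) * (2 / \<delta> ^ 3) * W"
      using \<open>\<delta> > 0\<close> \<open>W \<ge> 0\<close> by (intro mult_right_mono) auto
    moreover have "norm (slash_diff a b c d i j \<tau>) \<le> norm (of_int i * \<alpha> - of_int j * \<alpha>) * (2 / \<delta> ^ 3) * W"
      unfolding slash_diff_def Let_def W_def \<alpha>_def
      by (rule wp_diff_bound) (use \<delta>[OF \<tau>] assms in auto)
    ultimately show "norm (slash_diff a b c d i j \<tau>) \<le> L * (2 / \<delta> ^ 3) * W * (1 + norm \<tau>)"
      by (simp add: mult_ac)
  qed
qed

text \<open>Translation by 10 replaces the basis by another basis of the same lattice and moves each
  torsion point by a lattice vector, so 10 is a cusp width valid for every matrix.\<close>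

lemma slash_diff_periodic:
  assumes ij: "i \<in> {1..9}" "j \<in> {1..9}" and \<tau>: "Im \<tau> > 0"
  shows "slash_diff a b c d i j (\<tau> + 10) = slash_diff a b c d i j \<tau>"
proof -
  define \<alpha> \<beta> where "\<alpha> = of_int a * \<tau> + of_int b" and "\<beta> = of_int c * \<tau> + of_int d"
  interpret lattice "10 * \<alpha>" \<beta>
    by unfold_locales (use slash_lattice_det[of \<tau>] \<tau> in \<open>simp only: \<alpha>_def \<beta>_def\<close>)
  have off: "off (of_int k * \<alpha>)" if "k \<in> {1..9}" for k
  proof -
    obtain \<delta> where \<delta>: "\<And>\<tau>' i. Im \<tau>' \<ge> Im \<tau> \<Longrightarrow> \<bar>Re \<tau>'\<bar> \<le> \<bar>Re \<tau>\<bar> \<Longrightarrow> i \<in> {1..9} \<Longrightarrow>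
      separated UNIV \<delta> (10 * (of_int a * \<tau>' + of_int b)) (of_int c * \<tau>' + of_int d) (of_int i * (of_int a * \<tau>' + of_int b))"
      using separated_slash[OF \<tau>] by blast
    have "separated UNIV \<delta> (10 * \<alpha>) \<beta> (of_int k * \<alpha>)"
      unfolding \<alpha>_def \<beta>_def using that by (intro \<delta>) auto
    thus ?thesis unfolding off_def using separatedD by blast
  qed
  \<comment> \<open>Writing 1 as this combination expresses the increments \<open>10 * a\<close> and
    \<open>10 * c\<close> through the old basis with integer coefficients.\<close>
  have "of_int a * \<beta> - of_int c * \<alpha> = of_int (a * d - b * c)"
    by (simp add: \<alpha>_def \<beta>_def algebra_simps)
  hence one: "of_int a * \<beta> - of_int c * \<alpha> = 1" by (simp add: det)
  have \<alpha>': "of_int a * (\<tau> + 10) + of_int b = \<alpha> + 10 * of_int a * (of_int a * \<beta> - of_int c * \<alpha>)"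
    unfolding one by (simp add: \<alpha>_def algebra_simps)
  have \<beta>': "of_int c * (\<tau> + 10) + of_int d = \<beta> + 10 * of_int c * (of_int a * \<beta> - of_int c * \<alpha>)"
    unfolding one by (simp add: \<beta>_def algebra_simps)
  have 1: "10 * (of_int a * (\<tau> + 10) + of_int b) = of_int (1 - 10 * a * c) * (10 * \<alpha>) + of_int (100 * a ^ 2) * \<beta>"
    unfolding \<alpha>' by (simp add: algebra_simps power2_eq_square)
  have 2: "of_int c * (\<tau> + 10) + of_int d = of_int (- (c ^ 2)) * (10 * \<alpha>) + of_int (1 + 10 * a * c) * \<beta>"
    unfolding \<beta>' by (simp add: algebra_simps power2_eq_square)
  have 3: "of_int k * (of_int a * (\<tau> + 10) + of_int b) =
      of_int k * \<alpha> + of_int (- (k * a * c)) * (10 * \<alpha>) + of_int (10 * k * a ^ 2) * \<beta>" for k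
    unfolding \<alpha>' by (simp add: algebra_simps power2_eq_square)
  have "slash_diff a b c d i j (\<tau> + 10) = wp_diff (of_int (1 - 10 * a * c) * (10 * \<alpha>) + of_int (100 * a ^ 2) * \<beta>)
     (of_int (- (c ^ 2)) * (10 * \<alpha>) + of_int (1 + 10 * a * c) * \<beta>)
     (of_int i * \<alpha> + of_int (- (i * a * c)) * (10 * \<alpha>) + of_int (10 * i * a ^ 2) * \<beta>)
     (of_int j * \<alpha> + of_int (- (j * a * c)) * (10 * \<alpha>) + of_int (10 * j * a ^ 2) * \<beta>)"
    unfolding slash_diff_def Let_def 1 2 3 ..
  also have "\<dots> = wp_diff (10 * \<alpha>) \<beta>
     (of_int i * \<alpha> + of_int (- (i * a * c)) * (10 * \<alpha>) + of_int (10 * i * a ^ 2) * \<beta>)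
     (of_int j * \<alpha> + of_int (- (j * a * c)) * (10 * \<alpha>) + of_int (10 * j * a ^ 2) * \<beta>)"
    by (rule wp_diff_change_basis) (simp add: algebra_simps power2_eq_square)
  also have "\<dots> = wp_diff (10 * \<alpha>) \<beta> (of_int i * \<alpha>)
     (of_int j * \<alpha> + of_int (- (j * a * c)) * (10 * \<alpha>) + of_int (10 * j * a ^ 2) * \<beta>)"
  proof (rule wp_diff_translate[OF off[OF ij(1)]])
    show "off (of_int j * \<alpha> + of_int (- (j * a * c)) * (10 * \<alpha>) + of_int (10 * j * a ^ 2) * \<beta>)"
      using off_add[OF off[OF ij(2)], of "(- (j * a * c), 10 * j * a ^ 2)"]
      unfolding lat_def prod.case add.assoc .
  qed
  also have "\<dots> = wp_diff (10 * \<alpha>) \<beta> (of_int i * \<alpha>) (of_int j * \<alpha>)"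
    by (rule wp_diff_translate_right[OF off[OF ij(1)] off[OF ij(2)]])
  finally show ?thesis unfolding slash_diff_def Let_def \<alpha>_def \<beta>_def .
qed

end

section \<open>Torsion differences under the congruence subgroup\<close>

lemma torsion_diff_holomorphic:
  assumes "i \<in> {1..9}" "j \<in> {1..9}"
  shows "torsion_diff i j holomorphic_on upper_half_plane"
  unfolding torsion_diff_eq_slash by (rule slash_diff_holomorphic) (use assms in auto)

text \<open>As 10 divides the lower left entry, the transformed periods form a basis of the original
  lattice, and modulo the period 1 the torsion points are merely multiplied by
  \<open>a'\<close>.\<close>

lemma (in upper_half) torsion_diff_Gamma0:
  assumes G: "(a', b', c', d') \<in> Gamma0 10" and ij: "\<not> 10 dvd i" "\<not> 10 dvd j"
  shows "torsion_diff i j (moebius_int a' b' c' d' \<tau>)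
       = (of_int c' * \<tau> + of_int d') ^ 2 * torsion_diff (i * a') (j * a') \<tau>"
proof -
  from G obtain e where det: "a' * d' - b' * c' = 1" and e: "c' = 10 * e"
    by (auto simp: Gamma0_def)
  \<comment> \<open>The determinant condition makes \<open>a'\<close> invertible modulo 10, with
    inverse \<open>d'\<close>.\<close>
  have nd: "\<not> 10 dvd (k * a')" if "\<not> 10 dvd k" for k
  proof
    assume "10 dvd (k * a')"
    hence "10 dvd (k * a') * d'" by (rule dvd_mult2)
    hence "10 dvd (k * a') * d' - k * (b' * c')" using e by (intro dvd_diff) auto
    also have "(k * a') * d' - k * (b' * c') = k * (a' * d' - b' * c')" by (simp add: algebra_simps)
    finally show False using that det by simp
  qed
  define \<alpha> where "\<alpha> = of_int a' * \<tau> + of_int b'"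
  have "slash_diff a' b' c' d' i j \<tau> = wp_diff (of_int a' * (10 * \<tau>) + of_int (10 * b') * 1)
      (of_int e * (10 * \<tau>) + of_int d' * 1) (of_int i * \<alpha>) (of_int j * \<alpha>)"
    by (simp add: slash_diff_def e \<alpha>_def algebra_simps)
  also have "\<dots> = wp_diff (10 * \<tau>) 1 (of_int i * \<alpha>) (of_int j * \<alpha>)"
    by (rule wp_diff_change_basis) (use det e in \<open>simp add: algebra_simps\<close>)
  also have "\<dots> = wp_diff (10 * \<tau>) 1 (of_int (i * a') * \<tau> + of_int 0 * (10 * \<tau>) + of_int (i * b') * 1)
       (of_int (j * a') * \<tau> + of_int 0 * (10 * \<tau>) + of_int (j * b') * 1)"
    by (simp add: \<alpha>_def algebra_simps)
  also have "\<dots> = wp_diff (10 * \<tau>) 1 (of_int (i * a') * \<tau>)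
       (of_int (j * a') * \<tau> + of_int 0 * (10 * \<tau>) + of_int (j * b') * 1)"
  proof (rule wp_diff_translate[OF off_torsion[OF nd[OF ij(1)]]])
    show "off (of_int (j * a') * \<tau> + of_int 0 * (10 * \<tau>) + of_int (j * b') * 1)"
      using off_add[OF off_torsion[OF nd[OF ij(2)]], of "(0, j * b')"] by (simp add: lat_def)
  qed
  also have "\<dots> = torsion_diff (i * a') (j * a') \<tau>"
    unfolding torsion_diff_def
    by (rule wp_diff_translate_right[OF off_torsion[OF nd[OF ij(1)]] off_torsion[OF nd[OF ij(2)]]])
  finally show ?thesis
    using torsion_diff_moebius[OF moebius_denominator_nonzero[OF det Im_\<tau>]] by simp
qed

lemma (in upper_half) torsion_ratio_Gamma0:
  assumes G: "(a', b', c', d') \<in> Gamma0 10"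
  shows "torsion_diff 4 2 (moebius_int a' b' c' d' \<tau>) / torsion_diff 3 1 (moebius_int a' b' c' d' \<tau>)
       = torsion_diff 4 2 \<tau> / torsion_diff 3 1 \<tau>"
proof -
  from G have det: "a' * d' - b' * c' = 1" and c': "10 dvd c'"
    by (auto simp: Gamma0_def)
  have "odd a'"
  proof
    assume "even a'"
    hence "even (a' * d' - b' * c')" using c' by (intro dvd_diff dvd_mult2 dvd_mult) auto
    thus False by (simp add: det)
  qed
  moreover have "\<not> 5 dvd a'"
  proof
    assume "5 dvd a'"
    moreover have "5 dvd c'" using c' by (rule dvd_trans[rotated]) simp
    ultimately have "5 dvd (a' * d' - b' * c')" by (intro dvd_diff dvd_mult2 dvd_mult) auto
    thus False by (simp add: det)
  qed
  ultimately have "(10 dvd (a' - 1) \<or> 10 dvd (a' + 1)) \<or> (10 dvd (a' - 3) \<or> 10 dvd (a' + 3))"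
    by presburger
  then consider "10 dvd (a' - 1) \<or> 10 dvd (a' + 1)" | "10 dvd (a' - 3) \<or> 10 dvd (a' + 3)"
    by blast
  then have "torsion_diff (4 * a') (2 * a') \<tau> / torsion_diff (3 * a') (1 * a') \<tau> = torsion_diff 4 2 \<tau> / torsion_diff 3 1 \<tau>"
  proof cases
    case 1
    have "torsion_diff (4 * a') (2 * a') \<tau> = torsion_diff 4 2 \<tau>"
      by (rule torsion_diff_cong) (use 1 in presburger)+
    moreover have "torsion_diff (3 * a') (1 * a') \<tau> = torsion_diff 3 1 \<tau>"
      by (rule torsion_diff_cong) (use 1 in presburger)+
    ultimately show ?thesis by simp
  next
    case 2
    \<comment> \<open>Up to sign modulo 10, multiplication by 3 sends 4, 2, 3, 1 to 2, 4, 1, 3. Both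
      differences are reversed, and the two signs cancel in the quotient.\<close>
    have "torsion_diff (4 * a') (2 * a') \<tau> = torsion_diff 2 4 \<tau>"
      by (rule torsion_diff_cong) (use 2 in presburger)+
    moreover have "torsion_diff (3 * a') (1 * a') \<tau> = torsion_diff 1 3 \<tau>"
      by (rule torsion_diff_cong) (use 2 in presburger)+
    ultimately show ?thesis
      using torsion_diff_minus[of 2 4 \<tau>] torsion_diff_minus[of 1 3 \<tau>] by simp
  qed
  thus ?thesis
    using torsion_diff_Gamma0[OF G, of 4 2] torsion_diff_Gamma0[OF G, of 3 1]
      moebius_denominator_nonzero[OF det Im_\<tau>] by simp
qed

section \<open>Expansions at the cusps\<close>

text \<open>Periodicity makes \<open>S\<close> a function of the local parameter, holomorphic on the
  punctured disc. Linear growth in \<open>\<tau>\<close> is at most of order 1/|q|, so q^2 times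
  this function tends to 0 and an essential singularity is excluded.\<close>

lemma q_expansion:
  fixes h :: nat
  assumes h: "h > 0"
    and hol: "S holomorphic_on upper_half_plane"
    and per: "\<And>\<tau>. Im \<tau> > 0 \<Longrightarrow> S (\<tau> + of_nat h) = S \<tau>"
    and bound: "\<And>\<tau>. Im \<tau> \<ge> 1 \<Longrightarrow> \<bar>Re \<tau>\<bar> \<le> real h \<Longrightarrow> norm (S \<tau>) \<le> K * (1 + norm \<tau>)"
  obtains F where "\<And>\<tau>. \<tau> \<in> upper_half_plane \<Longrightarrow> S \<tau> = F (exp (2 * of_real pi * \<i> * \<tau> / of_nat h))"
    "isolated_singularity_at F 0" "not_essential F 0"
proof -
  define T where "T = (\<lambda>u :: complex. of_nat h * u / (2 * of_real pi * \<i>))"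
  have Im_T: "Im (T u) = - real h * Re u / (2 * pi)" and Re_T: "Re (T u) = real h * Im u / (2 * pi)" for u
    by (simp_all add: T_def Im_divide Re_divide power2_eq_square field_simps)
  have per_int: "S (\<tau> + of_int k * of_nat h) = S \<tau>" if "Im \<tau> > 0" for \<tau> k
  proof (induction k rule: int_induct[where k = 0])
    case (step1 i)
    thus ?case using per[of "\<tau> + of_int i * of_nat h"] that by (simp add: algebra_simps)
  next
    case (step2 i)
    thus ?case using per[of "\<tau> + of_int (i - 1) * of_nat h"] that by (simp add: algebra_simps)
  qed auto
  \<comment> \<open>The branch cut of \<open>Ln\<close> is harmless: two logarithms of
    \<open>q\<close> differ by a multiple of 2 pi i, which \<open>T\<close> turns into a multiple of
    the period.\<close>
  define F where "F = (\<lambda>q. S (T (Ln q)))"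
  have F: "F q = S (T u)" if "exp u = q" "norm q < 1" for q u
  proof -
    have "q \<noteq> 0" using that by auto
    hence "exp (Ln q) = exp u" using that by simp
    then obtain n :: int where n: "Ln q = u + of_real (of_int (2 * n) * pi) * \<i>"
      unfolding exp_eq by blast
    have "Re u < 0" using that by (auto simp flip: that(1))
    hence "Im (T u) > 0" using h by (simp add: Im_T field_simps mult_less_0_iff)
    moreover have "T (Ln q) = T u + of_int n * of_nat h"
      unfolding n by (simp add: T_def field_simps)
    ultimately show ?thesis by (simp only: F_def per_int)
  qed
  have S_eq: "S \<tau> = F (exp (2 * of_real pi * \<i> * \<tau> / of_nat h))" if "\<tau> \<in> upper_half_plane" for \<tau>
  proof -
    have "F (exp (2 * of_real pi * \<i> * \<tau> / of_nat h)) = S (T (2 * of_real pi * \<i> * \<tau> / of_nat h))"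
      by (rule F) (use that h in \<open>auto simp: upper_half_plane_def\<close>)
    thus ?thesis using h by (simp add: T_def)
  qed
  have T_hp: "T u \<in> upper_half_plane" if "Re u < 0" for u
    using that h by (simp add: upper_half_plane_def Im_T field_simps mult_less_0_iff)
  have Re_Ln: "Re (Ln q) < 0" if "q \<in> ball 0 1 - {0}" for q
    using that by (auto simp: dist_norm)
  have ST: "(\<lambda>q. S (T (f q))) holomorphic_on A" if "f holomorphic_on A" "\<And>q. q \<in> A \<Longrightarrow> Re (f q) < 0" for f A
  proof -
    have "(\<lambda>q. T (f q)) holomorphic_on A"
      unfolding T_def using that by (intro holomorphic_intros) auto
    thus ?thesis
      using holomorphic_on_compose_gen[OF _ hol, of "\<lambda>q. T (f q)" A] that T_hp by (auto simp: o_def)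
  qed
  have op: "open (ball 0 1 - \<real>\<^sub>\<le>\<^sub>0 :: complex set)" "open (ball 0 1 - \<real>\<^sub>\<ge>\<^sub>0 :: complex set)"
    by (auto intro!: open_Diff)
  have "F holomorphic_on (ball 0 1 - \<real>\<^sub>\<le>\<^sub>0)"
    unfolding F_def by (intro ST holomorphic_intros Re_Ln) auto
  moreover have "F holomorphic_on (ball 0 1 - \<real>\<^sub>\<ge>\<^sub>0)"
  proof -
    \<comment> \<open>A second logarithm with its cut on the other half-axis; the two slit discs
      together cover the punctured disc.\<close>
    have "(\<lambda>q. S (T (Ln (- q) + of_real pi * \<i>))) holomorphic_on (ball 0 1 - \<real>\<^sub>\<ge>\<^sub>0)"
    proof (intro ST holomorphic_intros)
      fix q :: complex assume q: "q \<in> ball 0 1 - \<real>\<^sub>\<ge>\<^sub>0"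
      show "- q \<notin> \<real>\<^sub>\<le>\<^sub>0" using q by (auto simp: complex_nonpos_Reals_iff complex_nonneg_Reals_iff)
      have "Re (Ln (- q)) < 0" by (rule Re_Ln) (use q in auto)
      thus "Re (Ln (- q) + of_real pi * \<i>) < 0" by simp
    qed
    moreover have "S (T (Ln (- q) + of_real pi * \<i>)) = F q" if "q \<in> ball 0 1 - \<real>\<^sub>\<ge>\<^sub>0" for q
    proof (rule F[symmetric])
      have "q \<noteq> 0" using that by auto
      thus "exp (Ln (- q) + of_real pi * \<i>) = q" by (simp add: exp_add)
    qed (use that in auto)
    ultimately show ?thesis by (rule holomorphic_transform)
  qed
  ultimately have "F holomorphic_on (ball 0 1 - \<real>\<^sub>\<le>\<^sub>0) \<union> (ball 0 1 - \<real>\<^sub>\<ge>\<^sub>0)"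
    using op by (intro holomorphic_on_Un)
  moreover have "(ball 0 1 - \<real>\<^sub>\<le>\<^sub>0) \<union> (ball 0 1 - \<real>\<^sub>\<ge>\<^sub>0) = (ball 0 1 - {0} :: complex set)"
    by (auto simp: complex_nonpos_Reals_iff complex_nonneg_Reals_iff complex_eq_iff)
  ultimately have F_hol: "F holomorphic_on (ball 0 1 - {0})" by simp
  hence iso: "isolated_singularity_at F 0"
    by (rule isolated_singularity_at_holomorphic) auto
  define C where "C = \<bar>K\<bar> * (1 + real h * (1 + pi))"
  \<comment> \<open>The radius exp(-2 pi) guarantees that \<open>T (Ln q)\<close> has imaginary part
    at least 1, where the growth bound applies.\<close>
  have q2F: "norm (q ^ 2 * F q) \<le> C * norm q" if q: "q \<in> ball 0 (exp (- 2 * pi)) - {0}" for q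
  proof -
    have q0: "q \<noteq> 0" "norm q < exp (- 2 * pi)" using q by auto
    have q1: "norm q < 1" by (rule order_less_trans[OF q0(2)]) simp
    have ln: "ln (norm q) < - 2 * pi" using q0 by (metis ln_exp ln_less_cancel_iff exp_gt_zero zero_less_norm_iff)
    have Im_Ln: "\<bar>Im (Ln q)\<bar> \<le> pi"
      using mpi_less_Im_Ln[of q] Im_Ln_le_pi[of q] q0 by (simp add: abs_le_iff)
    have Re_Ln_q: "Re (Ln q) = ln (norm q)" using q0 by simp
    have "1 \<le> real h" using h by simp
    also have "real h * 1 \<le> real h * (- ln (norm q) / (2 * pi))"
      using ln by (intro mult_left_mono) (auto simp: field_simps)
    finally have "1 \<le> Im (T (Ln q))" by (simp add: Im_T Re_Ln_q)
    moreover have "\<bar>Re (T (Ln q))\<bar> \<le> real h"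
    proof -
      have "\<bar>Im (Ln q)\<bar> / (2 * pi) \<le> 1" using Im_Ln by (simp add: divide_le_eq)
      hence "real h * (\<bar>Im (Ln q)\<bar> / (2 * pi)) \<le> real h * 1" by (intro mult_left_mono) auto
      thus ?thesis by (simp add: Re_T abs_mult)
    qed
    ultimately have "norm (F q) \<le> K * (1 + norm (T (Ln q)))"
      unfolding F_def by (rule bound)
    also have "\<dots> \<le> \<bar>K\<bar> * (1 + norm (T (Ln q)))"
      by (intro mult_right_mono) auto
    also have "norm (T (Ln q)) = real h * (norm (Ln q) / (2 * pi))"
      by (simp add: T_def norm_divide norm_mult)
    also have "norm (Ln q) / (2 * pi) \<le> norm (Ln q)"
      using pi_gt3 mult_left_mono[of 1 "2 * pi" "norm (Ln q)"] by (simp add: divide_le_eq)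
    also have "norm (Ln q) \<le> 1 / norm q + pi"
    proof -
      \<comment> \<open>This crude bound on the logarithm suffices: it costs one factor |q| and
        leaves another to tend to 0.\<close>
      have "ln (1 / norm q) \<le> 1 / norm q - 1" using q0 by (intro ln_le_minus_one) auto
      moreover have "ln (norm q) < 0" using ln pi_gt_zero by linarith
      ultimately have "\<bar>ln (norm q)\<bar> \<le> 1 / norm q" using q0 by (simp add: ln_div)
      thus ?thesis using cmod_le[of "Ln q"] Im_Ln Re_Ln_q by simp
    qed
    finally have "norm (F q) \<le> \<bar>K\<bar> * (1 + real h * (1 / norm q + pi))"
      by (simp add: mult_left_mono)
    hence "norm (q ^ 2 * F q) \<le> norm q ^ 2 * (\<bar>K\<bar> * (1 + real h * (1 / norm q + pi)))"
      unfolding norm_mult norm_power by (intro mult_left_mono) auto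
    also have "\<dots> = \<bar>K\<bar> * (norm q * 1 + real h * (1 + pi * norm q)) * norm q"
      using q0 by (simp add: field_simps power2_eq_square)
    also have "\<dots> \<le> \<bar>K\<bar> * (1 * 1 + real h * (1 + pi * 1)) * norm q"
      using q1 by (intro mult_right_mono mult_left_mono add_mono) auto
    finally show ?thesis by (simp add: C_def)
  qed
  have "((\<lambda>q. q ^ 2 * F q) \<longlongrightarrow> 0) (at 0)"
  proof (rule Lim_null_comparison)
    have "eventually (\<lambda>q. q \<in> ball 0 (exp (- 2 * pi)) - {0}) (at (0 :: complex))"
      by (intro eventually_at_in_open) auto
    thus "eventually (\<lambda>q. norm (q ^ 2 * F q) \<le> C * norm q) (at 0)"
      by eventually_elim (rule q2F)
    show "((\<lambda>q. C * norm q) \<longlongrightarrow> 0) (at (0 :: complex))"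
      by (rule tendsto_eq_intros refl)+ simp
  qed
  hence ne: "not_essential (\<lambda>q. q ^ 2 * F q) 0" by (auto simp: not_essential_def)
  have "isolated_singularity_at (\<lambda>q. q ^ 2 * F q) 0"
    by (rule isolated_singularity_at_holomorphic[of _ "ball 0 1"])
       (auto intro!: holomorphic_intros F_hol)
  \<comment> \<open>Meromorphy at 0 is preserved when dividing by q^2, and the quotient agrees with
    \<open>F\<close> away from 0.\<close>
  with ne have "(\<lambda>q. q ^ 2 * F q) meromorphic_on {0}" by (simp add: meromorphic_at_iff)
  hence "(\<lambda>q. q ^ 2 * F q / q ^ 2) meromorphic_on {0}"
    by (rule meromorphic_on_divide) (intro meromorphic_intros)
  hence "not_essential (\<lambda>q. q ^ 2 * F q / q ^ 2) 0" by (simp only: meromorphic_at_iff)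
  hence "not_essential F 0"
  proof (rule not_essential_transform)
    show "eventually (\<lambda>q. q ^ 2 * F q / q ^ 2 = F q) (at 0)"
      using eventually_neq_at_within[of 0] by eventually_elim simp
  qed
  with S_eq iso show ?thesis by (rule that)
qed

definition torsion_ratio :: "complex \<Rightarrow> complex" where
  "torsion_ratio \<tau> = torsion_diff 4 2 \<tau> / torsion_diff 3 1 \<tau>"

text \<open>In the quotient the weight 2 factors cancel, leaving two slashed lattice sums, each with
  a nonessential expansion in the parameter of width 10.\<close>

lemma torsion_ratio_at_cusp:
  assumes det: "a * d - b * c = (1 :: int)"
  obtains F where "\<And>\<tau>. \<tau> \<in> upper_half_plane \<Longrightarrow>
      torsion_ratio (moebius_int a b c d \<tau>) = F (exp (2 * of_real pi * \<i> * \<tau> / of_nat 10))"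
    "isolated_singularity_at F 0" "not_essential F 0"
proof -
  have "\<exists>F. (\<forall>\<tau>\<in>upper_half_plane. slash_diff a b c d i j \<tau> = F (exp (2 * of_real pi * \<i> * \<tau> / of_nat 10)))
     \<and> isolated_singularity_at F 0 \<and> not_essential F 0" if ij: "i \<in> {1..9}" "j \<in> {1..9}" for i j
  proof -
    obtain K where "\<And>\<tau>. Im \<tau> \<ge> 1 \<Longrightarrow> \<bar>Re \<tau>\<bar> \<le> real 10 \<Longrightarrow> norm (slash_diff a b c d i j \<tau>) \<le> K * (1 + norm \<tau>)"
      using slash_diff_bound[OF det ij] by metis
    with slash_diff_holomorphic[OF det ij] slash_diff_periodic[OF det ij] show ?thesis
      using q_expansion[of 10 "slash_diff a b c d i j" K] by (metis of_nat_numeral zero_less_numeral)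
  qed
  from this[of 4 2] this[of 3 1] obtain F G where
    F: "\<And>\<tau>. \<tau> \<in> upper_half_plane \<Longrightarrow> slash_diff a b c d 4 2 \<tau> = F (exp (2 * of_real pi * \<i> * \<tau> / of_nat 10))"
      "isolated_singularity_at F 0" "not_essential F 0" and
    G: "\<And>\<tau>. \<tau> \<in> upper_half_plane \<Longrightarrow> slash_diff a b c d 3 1 \<tau> = G (exp (2 * of_real pi * \<i> * \<tau> / of_nat 10))"
      "isolated_singularity_at G 0" "not_essential G 0"
    by (auto simp del: of_nat_numeral)
  show ?thesis
  proof (rule that[of "\<lambda>q. F q / G q"])
    fix \<tau> assume \<tau>: "\<tau> \<in> upper_half_plane"
    hence "of_int c * \<tau> + of_int d \<noteq> 0"
      using moebius_denominator_nonzero[OF det] by (simp add: upper_half_plane_def)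
    from torsion_diff_moebius[OF this, of _ _ a b] this
    have "torsion_ratio (moebius_int a b c d \<tau>) = slash_diff a b c d 4 2 \<tau> / slash_diff a b c d 3 1 \<tau>"
      by (simp add: torsion_ratio_def)
    thus "torsion_ratio (moebius_int a b c d \<tau>)
       = F (exp (2 * of_real pi * \<i> * \<tau> / of_nat 10)) / G (exp (2 * of_real pi * \<i> * \<tau> / of_nat 10))"
      by (simp only: F(1)[OF \<tau>] G(1)[OF \<tau>])
  qed (intro singularity_intros F G)+
qed

lemma moebius_upper_half_plane:
  "a * d - b * c = (1 :: int) \<Longrightarrow> \<tau> \<in> upper_half_plane \<Longrightarrow> moebius_int a b c d \<tau> \<in> upper_half_plane"
  using Im_moebius by (simp add: upper_half_plane_def)

text \<open>Invariance and nonessential cusp behaviour are transported through \<open>P\<close>, a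
  Laurent polynomial in both applications. Its only possible pole, 0, is avoided on the upper half
  plane, and \<open>mero\<close> carries the local expansion at each cusp through
  \<open>P\<close>.\<close>

lemma modular_function_on_of_torsion_ratio:
  assumes f: "\<And>\<tau>. \<tau> \<in> upper_half_plane \<Longrightarrow> f \<tau> = P (torsion_ratio \<tau>)"
    and hol: "P holomorphic_on - {0}"
    and nz: "\<And>\<tau>. \<tau> \<in> upper_half_plane \<Longrightarrow> torsion_ratio \<tau> \<noteq> 0 \<and> torsion_diff 3 1 \<tau> \<noteq> 0"
    and mero: "\<And>F. F meromorphic_on {0} \<Longrightarrow> (\<lambda>q. P (F q)) meromorphic_on {0}"
  shows "modular_function_on f (Gamma0 10)"
  unfolding modular_function_on_def
proof (intro conjI allI impI)
  have op: "open upper_half_plane" by (simp add: upper_half_plane_def open_halfspace_Im_gt)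
  have "torsion_ratio holomorphic_on upper_half_plane"
    unfolding torsion_ratio_def using nz by (intro holomorphic_intros torsion_diff_holomorphic) auto
  hence "(\<lambda>\<tau>. P (torsion_ratio \<tau>)) holomorphic_on upper_half_plane"
    using holomorphic_on_compose_gen[OF _ hol, of torsion_ratio upper_half_plane] nz
    by (force simp: o_def)
  hence "f holomorphic_on upper_half_plane"
    by (rule holomorphic_transform) (simp add: f)
  thus "f meromorphic_on upper_half_plane"
    using op by (intro analytic_on_imp_meromorphic_on) (simp add: analytic_on_open)
next
  show "\<forall>(a, b, c, d)\<in>Gamma0 10. \<forall>\<tau>\<in>upper_half_plane. f (moebius_int a b c d \<tau>) = f \<tau>"
  proof safe
    fix a b c d \<tau> assume G: "(a, b, c, d) \<in> Gamma0 10" and \<tau>: "\<tau> \<in> upper_half_plane"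
    interpret upper_half \<tau> using \<tau> by unfold_locales (simp add: upper_half_plane_def)
    have "moebius_int a b c d \<tau> \<in> upper_half_plane"
      using G \<tau> moebius_upper_half_plane by (auto simp: Gamma0_def)
    thus "f (moebius_int a b c d \<tau>) = f \<tau>"
      using torsion_ratio_Gamma0[OF G] \<tau> by (simp add: f torsion_ratio_def)
  qed
next
  fix a b c d :: int assume det: "a * d - b * c = 1"
  obtain F where F: "\<And>\<tau>. \<tau> \<in> upper_half_plane \<Longrightarrow>
      torsion_ratio (moebius_int a b c d \<tau>) = F (exp (2 * of_real pi * \<i> * \<tau> / of_nat 10))"
    "isolated_singularity_at F 0" "not_essential F 0"
    using torsion_ratio_at_cusp[OF det] by blast
  show "meromorphic_at_i_infinity (\<lambda>\<tau>. f (moebius_int a b c d \<tau>))"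
    unfolding meromorphic_at_i_infinity_def
  proof (intro exI[of _ 10] exI[of _ "\<lambda>q. P (F q)"] conjI ballI)
    fix \<tau> assume \<tau>: "\<tau> \<in> upper_half_plane"
    show "f (moebius_int a b c d \<tau>) = P (F (exp (2 * of_real pi * \<i> * \<tau> / of_nat 10)))"
      using f[OF moebius_upper_half_plane[OF det \<tau>]] F(1)[OF \<tau>] by (simp only:)
  qed (use mero[of F] F(2,3) in \<open>auto simp: meromorphic_at_iff\<close>)
qed

theorem theorem3p6:
  defines "U \<equiv> (\<lambda>\<tau>. I_fun \<tau> / J_fun \<tau>)"
  shows "modular_function_on (\<lambda>\<tau>. I_fun \<tau> ^ 4 + 1 / J_fun \<tau> ^ 4) (Gamma0 10)
    \<and> modular_function_on (\<lambda>\<tau>. J_fun \<tau> ^ 4 + 1 / I_fun \<tau> ^ 4) (Gamma0 10)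
    \<and> (\<forall>\<tau>\<in>upper_half_plane.
         I_fun \<tau> ^ 4 + 1 / J_fun \<tau> ^ 4 = 1 / U \<tau> ^ 2 - 2 + 3 * U \<tau> ^ 2
       \<and> J_fun \<tau> ^ 4 + 1 / I_fun \<tau> ^ 4 = 1 / U \<tau> ^ 6 - 2 / U \<tau> ^ 4 + 3 / U \<tau> ^ 2)"
proof (intro conjI ballI)
  \<comment> \<open>The right-hand sides of the two identities as functions of v = U^2.\<close>
  define P Q :: "complex \<Rightarrow> complex"
    where "P = (\<lambda>v. 1 / v - 2 + 3 * v)" and "Q = (\<lambda>v. 1 / v ^ 3 - 2 / v ^ 2 + 3 / v)"
  have ratio: "(I_fun \<tau> / J_fun \<tau>) ^ 2 = torsion_ratio \<tau>" "torsion_ratio \<tau> \<noteq> 0 \<and> torsion_diff 3 1 \<tau> \<noteq> 0"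
    and PQ: "I_fun \<tau> ^ 4 + 1 / J_fun \<tau> ^ 4 = P (torsion_ratio \<tau>)"
      "J_fun \<tau> ^ 4 + 1 / I_fun \<tau> ^ 4 = Q (torsion_ratio \<tau>)" if "\<tau> \<in> upper_half_plane" for \<tau>
  proof -
    interpret upper_half \<tau> using that by unfold_locales (simp add: upper_half_plane_def)
    show *: "(I_fun \<tau> / J_fun \<tau>) ^ 2 = torsion_ratio \<tau>"
      unfolding torsion_ratio_def by (rule U_squared_eq_torsion)
    show "torsion_ratio \<tau> \<noteq> 0 \<and> torsion_diff 3 1 \<tau> \<noteq> 0"
      using U_squared_nonzero torsion_diff_3_1_nonzero unfolding * by blast
    show "I_fun \<tau> ^ 4 + 1 / J_fun \<tau> ^ 4 = P (torsion_ratio \<tau>)"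
      "J_fun \<tau> ^ 4 + 1 / I_fun \<tau> ^ 4 = Q (torsion_ratio \<tau>)"
      using IJ_identities unfolding * P_def Q_def by blast+
  qed
  show "modular_function_on (\<lambda>\<tau>. I_fun \<tau> ^ 4 + 1 / J_fun \<tau> ^ 4) (Gamma0 10)"
  proof (rule modular_function_on_of_torsion_ratio[where P = P, OF PQ(1) _ ratio(2)])
    show "P holomorphic_on - {0}" unfolding P_def by (intro holomorphic_intros) auto
    fix F :: "complex \<Rightarrow> complex" assume "F meromorphic_on {0}"
    thus "(\<lambda>q. P (F q)) meromorphic_on {0}"
      unfolding P_def by (intro meromorphic_intros)
  qed
  show "modular_function_on (\<lambda>\<tau>. J_fun \<tau> ^ 4 + 1 / I_fun \<tau> ^ 4) (Gamma0 10)"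
  proof (rule modular_function_on_of_torsion_ratio[where P = Q, OF PQ(2) _ ratio(2)])
    show "Q holomorphic_on - {0}" unfolding Q_def by (intro holomorphic_intros) auto
    fix F :: "complex \<Rightarrow> complex" assume "F meromorphic_on {0}"
    thus "(\<lambda>q. Q (F q)) meromorphic_on {0}"
      unfolding Q_def by (intro meromorphic_intros)
  qed
  fix \<tau> assume \<tau>: "\<tau> \<in> upper_half_plane"
  have U: "U \<tau> ^ 2 = torsion_ratio \<tau>" "U \<tau> ^ 4 = torsion_ratio \<tau> ^ 2" "U \<tau> ^ 6 = torsion_ratio \<tau> ^ 3"
    unfolding U_def ratio(1)[OF \<tau>, symmetric] by (simp_all flip: power_mult)
  show "I_fun \<tau> ^ 4 + 1 / J_fun \<tau> ^ 4 = 1 / U \<tau> ^ 2 - 2 + 3 * U \<tau> ^ 2"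
    "J_fun \<tau> ^ 4 + 1 / I_fun \<tau> ^ 4 = 1 / U \<tau> ^ 6 - 2 / U \<tau> ^ 4 + 3 / U \<tau> ^ 2"
    unfolding U using PQ[OF \<tau>] by (simp_all only: P_def Q_def)
qed

end
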